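(* Let $S=\{a_n\}_{n\in\mathbb N}$ be a sequence of complex numbers satisfying (i)–(iii) of the context, with exponent of convergence $\alpha$, let $F$ be a characteristic function of $S$ of minimal growth order, and assume that a holomorphic branch of $\ln F$ in the sector $\mathcal I_\varepsilon^c$ satisfies $$\ln F(z)=\sum_{j=0}^N\sum_{k=0}^M d_{j,k}\,z^{\alpha-(j/m)}\ln^k z+o\big(z^{\alpha-(N/m)-\delta}\big),\qquad z\to\infty,\ z\in\mathcal I_\varepsilon^c,$$ for some $m,N\in\mathbb N$, $M\in\mathbb N\cup\{0\}$ and $\delta>0$ with $N/m>\alpha-\delta$. For $j\in\{0,\dots,N\}$ let $\bar k$ be the largest element of $\{0,\dots,M\}$ such that $d_{j,\bar k}\ne0$. Then $\zeta_S(s)$ has at the point $s=\alpha-(j/m)$: (1) a pole of order $\bar k+1$ if $\alpha-(j/m)\notin\mathbb Z$; (2) a pole of order $\bar k$ if $\alpha-(j/m)\in\mathbb Z\setminus\{0\}$, where a pole of order $0$ is a regular point. Moreover, $s=0$ is a regular point of $\zeta_S(s)$ whenever $M\in\{0,1\}$, and in this case $$\zeta_S(0)=\begin{cases}0,&\text{if }\alpha-(j/m)\ne0\text{ for any }j\in\{0,1,\dots,N\},\\ d_{j',1},&\text{if }\alpha-(j'/m)=0\text{ for some }j'\in\{0,1,\dots,N\},\end{cases}$$ noting that for $M=0$ one must have $d_{j',1}=0$. For $M\ge2$, $\zeta_S(s)$ develops, in general, a pole of order $M-1$ at $s=0$.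
   Context: Assumptions on $S=\{a_n\}_{n\in\mathbb N}\subset\mathbb C$: (i) $0<|a_1|\le|a_2|\le\dots\to\infty$; (ii) $\alpha=\limsup_{n\to\infty}(\ln n)/(\ln|a_n|)$ is finite; (iii) there exist $\varepsilon>0$ and $\Psi\in[-\pi,\pi)$ such that all $a_n\in\mathcal I_\varepsilon=\{z\in\mathbb C:\operatorname{Arg}(z)\notin(\Psi-\varepsilon,\Psi+\varepsilon)\}$ (arguments modulo $2\pi$); $\mathcal I_\varepsilon^c$ is the complementary sector around the ray $R_\Psi=\{te^{i\Psi}:t\ge0\}$. The $\zeta$-function is $\zeta_S(s)=\sum_{n=1}^\infty a_n^{-s}$ for $\Re(s)>\alpha$, with branch cut along $R_\Psi$: $z^{-s}=\exp(-s(\ln|z|+i\theta))$, $\theta\in(\Psi-2\pi,\Psi)$ being the argument of $z$. Statements about $\zeta_S$ to the left of $\Re(s)=\alpha$ refer to its analytic continuation (to $\Re(s)>\alpha-(N/m)-\delta$). A characteristic function of $S$ of minimal growth order is an entire function $F=e^{\omega}H$ with $\omega$ a polynomial of degree at most $\lfloor\alpha\rfloor$ and $H(z)=\prod_{n=1}^{\infty}(1-z/a_n)\exp\big[\sum_{j=1}^{\lfloor\alpha\rfloor}\frac1j(z/a_n)^j\big]$. In the asymptotic expansion, for $z\in\mathcal I_\varepsilon^c$, $\ln z=\ln|z|+i\theta$ with $\theta\in(\Psi-\varepsilon,\Psi+\varepsilon)$ the argument of $z$, and $z^\beta=e^{\beta\ln z}$. *)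

theory Defs
  imports "HOL-Complex_Analysis.Complex_Analysis" "HOL-Library.Landau_Symbols"
begin

text \<open>
  Sequences are indexed from 0: \<open>a n\<close> stands for the \<open>(n + 1)\<close>-st member of
  \<open>S = {a_1, a_2, ...}\<close>, which is why \<open>Suc n\<close> occurs in the exponent of convergence.
\<close>

definition exponent_of_convergence :: "(nat \<Rightarrow> complex) \<Rightarrow> ereal" where
  "exponent_of_convergence a = limsup (\<lambda>n. ereal (ln (real (Suc n)) / ln (cmod (a n))))"

text \<open>
  The sector around the ray \<open>R_\<Psi>\<close>. The point 0, where \<open>is_Arg\<close> holds for every angle, is left
  out, so that the sector is open.
\<close>

definition sector :: "real \<Rightarrow> real \<Rightarrow> complex set" where
  "sector \<Psi> \<epsilon> = {z. z \<noteq> 0 \<and> (\<exists>\<theta>. \<Psi> - \<epsilon> < \<theta> \<and> \<theta> < \<Psi> + \<epsilon> \<and> is_Arg z \<theta>)}"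

text \<open>
  The logarithm and the powers of \<open>z \<noteq> 0\<close> for the argument in the open interval \<open>(l, u)\<close>, which
  is unique when \<open>u - l \<le> 2 * pi\<close>.
\<close>

definition branch_ln :: "real \<Rightarrow> real \<Rightarrow> complex \<Rightarrow> complex" where
  "branch_ln l u z =
     complex_of_real (ln (cmod z)) + \<i> * complex_of_real (THE \<theta>. l < \<theta> \<and> \<theta> < u \<and> is_Arg z \<theta>)"

definition branch_power :: "real \<Rightarrow> real \<Rightarrow> complex \<Rightarrow> complex \<Rightarrow> complex" where
  "branch_power l u z \<beta> = exp (\<beta> * branch_ln l u z)"

definition canonical_product :: "(nat \<Rightarrow> complex) \<Rightarrow> real \<Rightarrow> complex \<Rightarrow> complex" where
  "canonical_product a \<alpha> z = (\<Prod>n. weierstrass_factor (nat \<lfloor>\<alpha>\<rfloor>) (z / a n))"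

definition minimal_characteristic_function ::
    "(nat \<Rightarrow> complex) \<Rightarrow> real \<Rightarrow> (complex \<Rightarrow> complex) \<Rightarrow> bool" where
  "minimal_characteristic_function a \<alpha> F \<longleftrightarrow>
     F holomorphic_on UNIV \<and>
     (\<exists>\<omega> :: complex poly. degree \<omega> \<le> nat \<lfloor>\<alpha>\<rfloor> \<and>
        (\<forall>z. F z = exp (poly \<omega> z) * canonical_product a \<alpha> z))"

text \<open>
  \<open>Z\<close> is the meromorphic continuation to the half-plane \<open>Re s > \<sigma>\<close> of the function given by
  the (convergent) series for \<open>Re s > \<alpha>\<close>. Being \<open>nicely_meromorphic_on\<close> means that removable
  singularities are filled in, so the values of \<open>Z\<close> on the half-plane are determined.
\<close>

definition zeta_continuation ::
    "(nat \<Rightarrow> complex) \<Rightarrow> real \<Rightarrow> real \<Rightarrow> real \<Rightarrow> (complex \<Rightarrow> complex) \<Rightarrow> bool" where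
  "zeta_continuation a \<Psi> \<alpha> \<sigma> Z \<longleftrightarrow>
     Z nicely_meromorphic_on {s. Re s > \<sigma>} \<and>
     (\<forall>s. Re s > \<alpha> \<longrightarrow> (\<lambda>n. branch_power (\<Psi> - 2 * pi) \<Psi> (a n) (- s)) sums Z s)"

text \<open>A pole of order 0 is a regular point.\<close>

definition pole_of_order :: "(complex \<Rightarrow> complex) \<Rightarrow> complex \<Rightarrow> nat \<Rightarrow> bool" where
  "pole_of_order f z n \<longleftrightarrow>
     (if n = 0 then f analytic_on {z}
      else isolated_singularity_at f z \<and> is_pole f z \<and> zorder f z = - int n)"

end

theory Submission
  imports Defs "HOL-Real_Asymp.Real_Asymp"
begin

text \<open>
  The idea is to read the zeta function off a two-sided Laplace integral along the zero-free ray
  and to continue that integral by means of the given expansion.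

  On the ray \<open>R_\<Psi>\<close> write \<open>z = exp (x + \<i> * \<Psi>)\<close> with real \<open>x\<close>, and write the zeros as
  \<open>a_n = exp b_n\<close> with \<open>0 < \<Psi> - Im b_n < 2 * pi\<close>, so that the powers in the zeta function are
  \<open>a_n^(-s) = exp (- s * b_n)\<close>. With \<open>p = \<lfloor>\<alpha>\<rfloor>\<close> and \<open>q = z / a_n\<close>, the logarithm of the \<open>n\<close>-th
  factor of the canonical product has \<open>x\<close>-derivative \<open>- q^(p + 1) / (1 - q)\<close>. The residue theorem on
  a rectangle of height \<open>2 * pi\<close> evaluates the integral of this function against \<open>exp (- s * x)\<close> for
  \<open>p < Re s < p + 1\<close> (\<open>exp_quotient_integral\<close>), and summation over \<open>n\<close> gives, for
  \<open>\<alpha> < Re s < p + 1\<close>,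
  \<open>\<zeta>(s) = E(s) * \<integral> exp (- s * x) * (d/dx) (ln F - \<omega>) dx\<close> with
  \<open>E(s) = (exp (2 * pi * \<i> * s) - 1) * exp (- \<i> * s * \<Psi>) / (2 * pi * \<i>)\<close> (\<open>zeta_mellin\<close>).

  The part \<open>x < 0\<close> of the integral is holomorphic for \<open>Re s < p + 1\<close>, since the derivative is
  \<open>O(exp ((p + 1) * x))\<close>. On \<open>x > 0\<close> an integration by parts replaces the derivative by
  \<open>s * (ln F - \<omega>)\<close>, up to a boundary value. There the expansion can be integrated term by term:
  a term \<open>z^\<beta> * (ln z)^k\<close> yields a rational function whose only pole is \<open>s = \<beta>\<close>, of
  order \<open>k + 1\<close>; the polynomial \<open>\<omega>\<close> yields simple poles at integers; the remainder yields a
  function holomorphic for \<open>Re s > \<alpha> - N/m - \<delta>\<close>. This is the continuation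
  (\<open>zeta_eq_continuation\<close>), and its poles are those of the integrated terms multiplied by \<open>s * E(s)\<close>.
  That factor has a zero of order 0, 1 or 2 at a point that is not an integer, a nonzero integer,
  or 0, which produces the pole orders \<open>k + 1\<close>, \<open>k\<close> and \<open>k - 1\<close> and removes the poles of \<open>\<omega>\<close>
  (\<open>local_form\<close>). The identity theorem shows that every continuation has the same poles and values. At \<open>s = 0\<close> it is \<open>s^2 * (1 + O(s))\<close>, so
  for \<open>M \<le> 1\<close> it cancels the double pole, and its product with \<open>d_{j',1} / s^2\<close> is the value at 0.
\<close>

section \<open>Laplace transforms on the half-line\<close>

lemma set_integrable_exp_minus:
  fixes c :: real
  assumes "c > 0"
  shows "set_integrable lborel {T..} (\<lambda>x. exp (- c * x))"
    and "(LINT x:{T..}|lborel. exp (- c * x)) = exp (- c * T) / c"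
proof -
  have "(\<integral>\<^sup>+x. ennreal (exp (- c * x)) * indicator {T..} x \<partial>lborel) = ennreal (0 - (- exp (- c * T) / c))"
  proof (rule nn_integral_FTC_atLeast)
    show "((\<lambda>x. - exp (- c * x) / c) \<longlongrightarrow> 0) at_top"
      using assms by real_asymp
  qed (use assms in \<open>auto intro!: derivative_eq_intros\<close>)
  then have "(\<integral>\<^sup>+x. ennreal (indicator {T..} x *\<^sub>R exp (- c * x)) \<partial>lborel) = ennreal (exp (- c * T) / c)"
    by (auto simp: indicator_def intro!: nn_integral_cong elim!: trans[rotated])
  then have "has_bochner_integral lborel (\<lambda>x. indicator {T..} x *\<^sub>R exp (- c * x)) (exp (- c * T) / c)"
    using assms by (intro has_bochner_integral_nn_integral) auto
  then show "set_integrable lborel {T..} (\<lambda>x. exp (- c * x))"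
    and "(LINT x:{T..}|lborel. exp (- c * x)) = exp (- c * T) / c"
    by (auto simp: set_integrable_def set_lebesgue_integral_def has_bochner_integral_iff)
qed


lemma bounded_on_half_line:
  fixes g :: "real \<Rightarrow> 'a::real_normed_vector"
  assumes cont: "continuous_on {0..} g" and ev: "eventually (\<lambda>x. norm (g x) \<le> B) at_top"
  obtains C where "C > 0" "\<And>x. x \<ge> 0 \<Longrightarrow> norm (g x) \<le> C"
proof -
  from ev obtain T where T: "\<And>x. x \<ge> T \<Longrightarrow> norm (g x) \<le> B"
    by (auto simp: eventually_at_top_linorder)
  have "compact (g ` {0..T})"
    by (intro compact_continuous_image continuous_on_subset[OF cont]) auto
  then obtain B' where B': "B' > 0" "\<And>y. y \<in> g ` {0..T} \<Longrightarrow> norm y \<le> B'"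
    using compact_imp_bounded bounded_pos by metis
  show thesis
  proof (rule that)
    show "max B B' > 0"
      using B' by auto
    show "norm (g x) \<le> max B B'" if "x \<ge> 0" for x
      using T[of x] B'(2)[of "g x"] that by (cases "x \<le> T") (auto simp: le_max_iff_disj)
  qed
qed

definition laplace :: "(real \<Rightarrow> complex) \<Rightarrow> complex \<Rightarrow> complex" where
  "laplace h s = (LINT x:{0..}|lborel. exp (- s * of_real x) * h x)"

lemma norm_exp_mult_le:
  fixes h :: "real \<Rightarrow> complex"
  assumes "norm (h x) \<le> C * exp (\<sigma> * x)"
  shows "norm (exp (- s * of_real x) * h x) \<le> C * exp (- (Re s - \<sigma>) * x)"
proof -
  have "norm (exp (- s * of_real x) * h x) \<le> exp (- Re s * x) * (C * exp (\<sigma> * x))"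
    unfolding norm_mult using assms by (intro mult_mono) auto
  also have "\<dots> = C * exp (- (Re s - \<sigma>) * x)"
    by (simp add: exp_add[symmetric] algebra_simps)
  finally show ?thesis .
qed

lemma laplace_integrable:
  assumes cont: "continuous_on {0..} h"
    and bound: "\<And>x. x \<ge> 0 \<Longrightarrow> norm (h x) \<le> C * exp (\<sigma> * x)"
    and s: "Re s > \<sigma>" and T: "T \<ge> 0"
  shows "set_integrable lborel {T..} (\<lambda>x. exp (- s * of_real x) * h x)"
proof (rule set_integrable_bound)
  show "set_integrable lborel {T..} (\<lambda>x. C * exp (- (Re s - \<sigma>) * x))"
    using set_integrable_exp_minus(1)[of "Re s - \<sigma>" T] s by (intro set_integrable_mult_right) auto
  have "continuous_on {T..} (\<lambda>x. exp (- s * of_real x) * h x)"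
    using T by (intro continuous_intros continuous_on_subset[OF cont]) auto
  then show "set_borel_measurable lborel {T..} (\<lambda>x. exp (- s * of_real x) * h x)"
    by (simp add: set_borel_measurable_def borel_measurable_continuous_on_indicator)
  show "AE x in lborel. x \<in> {T..} \<longrightarrow>
      norm (exp (- s * of_real x) * h x) \<le> norm (C * exp (- (Re s - \<sigma>) * x))"
  proof (intro always_eventually allI impI)
    fix x assume "x \<in> {T..}"
    then have "norm (exp (- s * of_real x) * h x) \<le> C * exp (- (Re s - \<sigma>) * x)"
      using T by (intro norm_exp_mult_le bound) auto
    then show "norm (exp (- s * of_real x) * h x) \<le> norm (C * exp (- (Re s - \<sigma>) * x))"
      by (metis abs_ge_self order_trans real_norm_def)
  qed
qed

text \<open>
  The integrals over \<open>[0, n]\<close> are entire in \<open>s\<close>, and on a small disc in the half-plane the tail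
  beyond \<open>n\<close> is \<open>O(exp (- \<kappa> * n))\<close> with a common \<open>\<kappa> > 0\<close>; so the Laplace transform is a locally
  uniform limit of holomorphic functions.
\<close>

lemma laplace_holomorphic:
  assumes cont: "continuous_on {0..} h"
    and bound: "\<And>x. x \<ge> 0 \<Longrightarrow> norm (h x) \<le> C * exp (\<sigma> * x)"
  shows "laplace h holomorphic_on {s. Re s > \<sigma>}"
proof (rule holomorphic_uniform_sequence)
  define F where "F = (\<lambda>(n::nat) s. integral {0..real n} (\<lambda>x. exp (- s * of_real x) * h x))"
  have ci: "set_integrable lborel {0..real n} (\<lambda>x. exp (- s * of_real x) * h x)" for n s
    by (intro borel_integrable_atLeastAtMost' continuous_intros continuous_on_subset[OF cont]) auto
  have F_eq: "F n s = (LINT x:{0..real n}|lborel. exp (- s * of_real x) * h x)" for n s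
    unfolding F_def using set_borel_integral_eq_integral(2)[OF ci] by simp
  show "open {s. Re s > \<sigma>}"
    by (simp add: open_halfspace_Re_gt)
  show "F n holomorphic_on {s. Re s > \<sigma>}" for n
    unfolding F_def cbox_interval[symmetric]
  proof (rule leibniz_rule_holomorphic)
    show "continuous_on ({s. Re s > \<sigma>} \<times> cbox 0 (real n))
        (\<lambda>(s, x). - of_real x * (exp (- s * of_real x) * h x))"
      unfolding case_prod_beta
      by (intro continuous_intros continuous_on_compose2[OF cont]) auto
    show "(\<lambda>x. exp (- s * of_real x) * h x) integrable_on cbox 0 (real n)" for s
      using set_borel_integral_eq_integral(1)[OF ci] by (simp add: cbox_interval)
    show "((\<lambda>s. exp (- s * of_real x) * h x) has_field_derivative
        - of_real x * (exp (- s * of_real x) * h x)) (at s within {s. Re s > \<sigma>})" for s x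
      by (auto intro!: derivative_eq_intros)
  qed (simp add: convex_halfspace_Re_gt)
  show "\<exists>d. 0 < d \<and> cball s0 d \<subseteq> {s. Re s > \<sigma>} \<and> uniform_limit (cball s0 d) F (laplace h) sequentially"
    if "s0 \<in> {s. Re s > \<sigma>}" for s0
  proof (intro exI conjI)
    define \<kappa> where "\<kappa> = (Re s0 - \<sigma>) / 2"
    show \<kappa>: "\<kappa> > 0"
      using that by (simp add: \<kappa>_def)
    have Re_ge: "Re s \<ge> \<sigma> + \<kappa>" if "s \<in> cball s0 \<kappa>" for s
    proof -
      have "Re s0 - Re s \<le> norm (s0 - s)"
        by (metis abs_Re_le_cmod abs_le_D1 minus_complex.simps(1))
      with that show ?thesis
        by (simp add: \<kappa>_def dist_norm field_simps)
    qed
    with \<kappa> show "cball s0 \<kappa> \<subseteq> {s. Re s > \<sigma>}"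
      by force
    have diff: "norm (F n s - laplace h s) \<le> C * (exp (- \<kappa> * real n) / \<kappa>)"
      if s: "s \<in> cball s0 \<kappa>" for s n
    proof -
      have s': "Re s > \<sigma>" "Re s - \<sigma> \<ge> \<kappa>"
        using Re_ge[OF s] \<kappa> by auto
      have C: "C \<ge> 0"
        using bound[of 0] norm_ge_zero[of "h 0"] by (metis exp_zero mult.right_neutral mult_zero_right order_trans order_refl)
      have "laplace h s = (LINT x:{0..real n} \<union> {real n<..}|lborel. exp (- s * of_real x) * h x)"
        unfolding laplace_def by (rule arg_cong2[of _ _ _ _ "set_lebesgue_integral lborel"]) auto
      also have "\<dots> = F n s + (LINT x:{real n<..}|lborel. exp (- s * of_real x) * h x)"
        unfolding F_eq using laplace_integrable[OF cont bound s'(1), of "real n"]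
        by (intro set_integral_Un ci) (auto elim: set_integrable_subset)
      also have "(LINT x:{real n<..}|lborel. exp (- s * of_real x) * h x) =
          (LINT x:{real n..}|lborel. exp (- s * of_real x) * h x)"
        by (rule set_integral_discrete_difference[of "{real n}"]) auto
      finally have "norm (F n s - laplace h s) =
          norm (LINT x:{real n..}|lborel. exp (- s * of_real x) * h x)"
        by (simp add: norm_minus_commute)
      also have "\<dots> \<le> (LINT x:{real n..}|lborel. norm (exp (- s * of_real x) * h x))"
        using laplace_integrable[OF cont bound s'(1), of "real n"] by (intro set_integral_norm_bound) auto
      also have "\<dots> \<le> (LINT x:{real n..}|lborel. C * exp (- \<kappa> * x))"
      proof (rule set_integral_mono)
        show "set_integrable lborel {real n..} (\<lambda>x. norm (exp (- s * of_real x) * h x))"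
          using laplace_integrable[OF cont bound s'(1), of "real n"] by (intro set_integrable_norm) auto
        show "set_integrable lborel {real n..} (\<lambda>x. C * exp (- \<kappa> * x))"
          using set_integrable_exp_minus[OF \<kappa>] by (intro set_integrable_mult_right) auto
        show "norm (exp (- s * of_real x) * h x) \<le> C * exp (- \<kappa> * x)" if "x \<in> {real n..}" for x
        proof -
          have x: "x \<ge> 0"
            using that of_nat_0_le_iff[of n] by (auto intro: order_trans)
          have "norm (exp (- s * of_real x) * h x) \<le> C * exp (- (Re s - \<sigma>) * x)"
            using x by (intro norm_exp_mult_le bound)
          also have "\<dots> \<le> C * exp (- \<kappa> * x)"
            using C mult_right_mono[OF s'(2) x] by (intro mult_left_mono) (auto simp: algebra_simps)
          finally show ?thesis .
        qed
      qed
      also have "\<dots> = C * (exp (- \<kappa> * real n) / \<kappa>)"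
        using set_integrable_exp_minus(2)[OF \<kappa>] by simp
      finally show ?thesis .
    qed
    have "(\<lambda>n. C * (exp (- \<kappa> * real n) / \<kappa>)) \<longlonglongrightarrow> 0"
      using \<kappa> by real_asymp
    then have "eventually (\<lambda>n. C * (exp (- \<kappa> * real n) / \<kappa>) < e) sequentially" if "e > 0" for e
      using that by (rule order_tendstoD)
    then show "uniform_limit (cball s0 \<kappa>) F (laplace h) sequentially"
      using diff unfolding uniform_limit_iff dist_norm
      by (smt (verit, ccfv_SIG) eventually_mono)
  qed
qed


text \<open>
  Integration by parts. The two functions are controlled in different ways: the expansion of \<open>ln F\<close>
  bounds \<open>g\<close> pointwise, but it cannot be differentiated; convergence of the transform of \<open>g'\<close> will
  come from the summation over the zeros.
\<close>

lemma laplace_derivative: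
  fixes g g' :: "real \<Rightarrow> complex"
  assumes deriv: "\<And>x. x \<ge> 0 \<Longrightarrow> (g has_vector_derivative g' x) (at x within {0..})"
    and cont: "continuous_on {0..} g'"
    and bound: "\<And>x. x \<ge> 0 \<Longrightarrow> norm (g x) \<le> C * exp (\<sigma> * x)"
    and s: "Re s > \<sigma>"
    and int: "set_integrable lborel {0..} (\<lambda>x. exp (- s * of_real x) * g' x)"
  shows "laplace g' s = s * laplace g s - g 0"
proof -
  have contg: "continuous_on {0..} g"
    unfolding continuous_on_eq_continuous_within by (metis atLeast_iff deriv has_vector_derivative_continuous)
  have intg: "set_integrable lborel {0..} (\<lambda>x. exp (- s * of_real x) * g x)"
    using laplace_integrable[OF contg bound s, of 0] by simp
  have intg': "set_integrable lborel {0..} (\<lambda>x. s * (exp (- s * of_real x) * g x))"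
    using intg by (intro set_integrable_mult_right)
  define f where "f = (\<lambda>x. exp (- s * of_real x) * g' x - s * (exp (- s * of_real x) * g x))"
  have intf: "set_integrable lborel {0..} f"
    unfolding f_def using int intg' by (rule set_integral_diff(1))
  have lim1: "((\<lambda>T. LINT x:{0..T}|lborel. f x) \<longlongrightarrow> (LINT x:{0..}|lborel. f x)) at_top"
    by (intro tendsto_set_lebesgue_integral_at_top intf) auto
  have eq: "(LINT x:{0..}|lborel. f x) = laplace g' s - s * laplace g s"
    unfolding f_def laplace_def using int intg' by (subst set_integral_diff(2)) auto
  have FTC: "(LINT x:{0..T}|lborel. f x) = exp (- s * of_real T) * g T - g 0" if T: "T \<ge> 0" for T
  proof -
    have "(LINT x|lborel. indicator {0..T} x *\<^sub>R f x) =
        exp (- s * of_real T) * g T - exp (- s * of_real 0) * g 0"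
    proof (rule integral_FTC_Icc[OF T])
      show "((\<lambda>x. exp (- s * of_real x) * g x) has_vector_derivative f x) (at x within {0..T})"
        if "0 \<le> x" "x \<le> T" for x
      proof -
        have "(g has_vector_derivative g' x) (at x within {0..T})"
          using deriv[OF that(1)] by (rule has_vector_derivative_within_subset) auto
        moreover have "((\<lambda>x. exp (- s * of_real x)) has_vector_derivative - s * exp (- s * of_real x))
            (at x within {0..T})"
          by (auto intro!: has_vector_derivative_real_field derivative_eq_intros)
        ultimately have "((\<lambda>x. exp (- s * of_real x) * g x) has_vector_derivative
            exp (- s * of_real x) * g' x + (- s * exp (- s * of_real x)) * g x) (at x within {0..T})"
          by (rule has_vector_derivative_mult[rotated])
        then show ?thesis
          by (simp add: f_def mult.assoc)
      qed
      show "continuous_on {0..T} f"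
        unfolding f_def
        by (intro continuous_intros continuous_on_subset[OF cont] continuous_on_subset[OF contg]) auto
    qed
    then show ?thesis
      by (simp add: set_lebesgue_integral_def)
  qed
  have "((\<lambda>T. exp (- s * of_real T) * g T) \<longlongrightarrow> 0) at_top"
  proof (rule Lim_null_comparison)
    show "eventually (\<lambda>T. norm (exp (- s * of_real T) * g T) \<le> C * exp (- (Re s - \<sigma>) * T)) at_top"
      using eventually_ge_at_top[of 0] by eventually_elim (intro norm_exp_mult_le bound)
    show "((\<lambda>T. C * exp (- (Re s - \<sigma>) * T)) \<longlongrightarrow> 0) at_top"
      using s by real_asymp
  qed
  then have "((\<lambda>T. exp (- s * of_real T) * g T - g 0) \<longlongrightarrow> 0 - g 0) at_top"
    by (intro tendsto_intros)
  moreover have "eventually (\<lambda>T. exp (- s * of_real T) * g T - g 0 = (LINT x:{0..T}|lborel. f x)) at_top"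
    using eventually_ge_at_top[of 0] by eventually_elim (simp add: FTC)
  ultimately have "((\<lambda>T. LINT x:{0..T}|lborel. f x) \<longlongrightarrow> 0 - g 0) at_top"
    by (rule Lim_transform_eventually)
  with lim1 have "(LINT x:{0..}|lborel. f x) = 0 - g 0"
    using tendsto_unique trivial_limit_at_top_linorder by blast
  with eq show ?thesis
    by (simp add: algebra_simps)
qed

text \<open>
  The numerator \<open>\<Sum>i\<le>k. k!/i! * (c * u)^i\<close> of the Laplace transform of \<open>(x + c)^k * exp (\<beta> * x)\<close>,
  in the form in which integration by parts produces it.
\<close>

fun laplace_numerator :: "complex \<Rightarrow> nat \<Rightarrow> complex \<Rightarrow> complex" where
  "laplace_numerator c 0 u = 1"
| "laplace_numerator c (Suc k) u = (c * u) ^ Suc k + of_nat (Suc k) * laplace_numerator c k u"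

lemma laplace_numerator_0 [simp]: "laplace_numerator c k 0 = fact k"
  by (induction k) simp_all

lemma laplace_numerator_holomorphic [holomorphic_intros]:
  "f holomorphic_on A \<Longrightarrow> (\<lambda>z. laplace_numerator c k (f z)) holomorphic_on A"
  by (induction k) (auto intro!: holomorphic_intros simp del: of_nat_Suc)

lemma polynomial_exponential_bound:
  fixes \<beta> c :: complex
  assumes "\<sigma> > Re \<beta>"
  obtains C where "C > 0" "\<And>x::real. x \<ge> 0 \<Longrightarrow> norm ((of_real x + c) ^ k * exp (\<beta> * of_real x)) \<le> C * exp (\<sigma> * x)"
proof -
  have "((\<lambda>x::real. (x + norm c) ^ k * exp ((Re \<beta> - \<sigma>) * x)) \<longlongrightarrow> 0) at_top"
    using assms by real_asymp
  then have "eventually (\<lambda>x::real. norm ((x + norm c) ^ k * exp ((Re \<beta> - \<sigma>) * x)) \<le> 1) at_top"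
    by (auto dest!: tendstoD[of _ _ _ 1] elim!: eventually_mono)
  then obtain C where C: "C > 0" "\<And>x::real. x \<ge> 0 \<Longrightarrow> norm ((x + norm c) ^ k * exp ((Re \<beta> - \<sigma>) * x)) \<le> C"
    by (rule bounded_on_half_line[rotated]) (auto intro!: continuous_intros)
  show thesis
  proof (rule that[OF C(1)])
    fix x :: real assume x: "x \<ge> 0"
    have "norm ((of_real x + c) ^ k * exp (\<beta> * of_real x)) \<le> (x + norm c) ^ k * exp (Re \<beta> * x)"
      using norm_triangle_ineq[of "of_real x" c] x
      by (auto simp: norm_mult norm_power intro!: mult_right_mono power_mono)
    also have "\<dots> = ((x + norm c) ^ k * exp ((Re \<beta> - \<sigma>) * x)) * exp (\<sigma> * x)"
      by (simp add: exp_add[symmetric] algebra_simps)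
    also have "\<dots> \<le> C * exp (\<sigma> * x)"
      using C(2)[OF x] x by (intro mult_right_mono) (auto simp: abs_mult)
    finally show "norm ((of_real x + c) ^ k * exp (\<beta> * of_real x)) \<le> C * exp (\<sigma> * x)" .
  qed
qed

lemma laplace_polynomial_exponential_integrable:
  assumes "Re s > Re \<beta>" "T \<ge> 0"
  shows "set_integrable lborel {T..} (\<lambda>x. exp (- s * of_real x) * ((of_real x + c) ^ k * exp (\<beta> * of_real x)))"
proof -
  from assms obtain \<sigma> where \<sigma>: "Re \<beta> < \<sigma>" "\<sigma> < Re s"
    using dense by blast
  obtain C where "\<And>x::real. x \<ge> 0 \<Longrightarrow> norm ((of_real x + c) ^ k * exp (\<beta> * of_real x)) \<le> C * exp (\<sigma> * x)"
    using polynomial_exponential_bound[OF \<sigma>(1)] by blast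
  then show ?thesis
    using \<sigma> assms by (intro laplace_integrable) (auto intro!: continuous_intros)
qed

text \<open>
  The shift \<open>c\<close> will be \<open>\<i> * \<Psi>\<close>, because \<open>ln z = x + \<i> * \<Psi>\<close> on the ray. The shifted monomial leaves the
  pole at \<open>\<beta>\<close> of order \<open>k + 1\<close>, with leading coefficient \<open>k!\<close> independent of \<open>c\<close>.
\<close>

lemma laplace_polynomial_exponential:
  assumes s: "Re s > Re \<beta>"
  shows "laplace (\<lambda>x. (of_real x + c) ^ k * exp (\<beta> * of_real x)) s =
    laplace_numerator c k (s - \<beta>) / (s - \<beta>) ^ Suc k"
proof -
  define g where "g = (\<lambda>k x. (of_real x + c) ^ k * exp (\<beta> * of_real x))"
  define g' where "g' = (\<lambda>k x. of_nat k * g (k - 1) x + \<beta> * g k x)"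
  have int: "set_integrable lborel {0..} (\<lambda>x. exp (- s * of_real x) * g k x)" for k
    unfolding g_def by (rule laplace_polynomial_exponential_integrable) (use s in auto)
  have int': "set_integrable lborel {0..} (\<lambda>x. of_nat k * (exp (- s * of_real x) * g (k - 1) x))"
    "set_integrable lborel {0..} (\<lambda>x. \<beta> * (exp (- s * of_real x) * g k x))" for k
    using int by (auto intro!: set_integrable_mult_right)
  have g'_eq: "exp (- s * of_real x) * g' k x = of_nat k * (exp (- s * of_real x) * g (k - 1) x)
      + \<beta> * (exp (- s * of_real x) * g k x)" for k x
    by (simp add: g'_def algebra_simps)
  have lap': "laplace (g' k) s = of_nat k * laplace (g (k - 1)) s + \<beta> * laplace (g k) s" for k
    unfolding laplace_def g'_eq using int' by (subst set_integral_add(2)) auto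
  obtain \<sigma> where \<sigma>: "Re \<beta> < \<sigma>" "\<sigma> < Re s"
    using dense[OF s] by blast
  have step: "laplace (g' k) s = s * laplace (g k) s - c ^ k" for k
  proof -
    obtain C where C: "\<And>x::real. x \<ge> 0 \<Longrightarrow> norm (g k x) \<le> C * exp (\<sigma> * x)"
      unfolding g_def using polynomial_exponential_bound[OF \<sigma>(1)] by blast
    have "laplace (g' k) s = s * laplace (g k) s - g k 0"
    proof (rule laplace_derivative[OF _ _ C \<sigma>(2)])
      show "(g k has_vector_derivative g' k x) (at x within {0..})" for x
        unfolding g_def g'_def
        by (auto intro!: has_vector_derivative_real_field derivative_eq_intros simp: algebra_simps)
      show "continuous_on {0..} (g' k)"
        unfolding g_def g'_def by (intro continuous_intros)
      show "set_integrable lborel {0..} (\<lambda>x. exp (- s * of_real x) * g' k x)"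
        unfolding g'_eq using int' by (rule set_integral_add(1))
    qed auto
    then show ?thesis
      by (simp add: g_def)
  qed
  have nz: "s - \<beta> \<noteq> 0"
    using s by auto
  have rec: "(s - \<beta>) * laplace (g k) s = c ^ k + of_nat k * laplace (g (k - 1)) s" for k
    using step[of k] lap'[of k] by (simp add: algebra_simps)
  have "laplace (g k) s = laplace_numerator c k (s - \<beta>) / (s - \<beta>) ^ Suc k"
  proof (induction k)
    case 0
    show ?case
      using rec[of 0] nz by (simp add: field_simps)
  next
    case (Suc k)
    have "laplace (g (Suc k)) s = (c ^ Suc k + of_nat (Suc k) * laplace (g k) s) / (s - \<beta>)"
      using rec[of "Suc k"] nz by (simp add: nonzero_eq_divide_eq mult.commute del: of_nat_Suc power_Suc)
    also have "\<dots> = laplace_numerator c (Suc k) (s - \<beta>) / (s - \<beta>) ^ Suc (Suc k)"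
      unfolding Suc laplace_numerator.simps using nz
      by (simp add: divide_simps power_mult_distrib del: of_nat_Suc)
    finally show ?case .
  qed
  then show ?thesis
    by (simp add: g_def)
qed

section \<open>The Laplace integral of a single zero\<close>

lemma exp_ratio_integrable:
  fixes v :: real
  assumes v: "0 < v" "v < 1"
  shows "integrable lborel (\<lambda>x. exp (v * x) / (1 + exp x))"
proof -
  define c where "c = min v (1 - v)"
  have c: "c > 0" "c \<le> v" "c \<le> 1 - v"
    using v by (auto simp: c_def)
  have *: "integrable lborel (\<lambda>x::real. indicator {0..} x *\<^sub>R exp (- c * x))"
    using set_integrable_exp_minus(1)[OF c(1), of 0] by (simp add: set_integrable_def)
  (* The majorant is essentially exp (- c * |x|), written as a function on the right half-line plus
     its reflection x \<mapsto> 0 + (- 1) * x. *)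
  have "integrable lborel (\<lambda>x::real. indicator {0..} x *\<^sub>R exp (- c * x)
      + indicator {0..} (0 + (- 1) * x) *\<^sub>R exp (- c * (0 + (- 1) * x)))"
    by (intro Bochner_Integration.integrable_add * lborel_integrable_real_affine[OF *]) auto
  then show ?thesis
  proof (rule Bochner_Integration.integrable_bound)
    show "AE x in lborel. norm (exp (v * x) / (1 + exp x)) \<le>
      norm (indicator {0..} x *\<^sub>R exp (- c * x) + indicator {0..} (0 + (- 1) * x) *\<^sub>R exp (- c * (0 + (- 1) * x)))"
    proof (intro always_eventually allI)
      fix x :: real
      have pos: "1 + exp x > 0"
        by (simp add: add_pos_pos)
      show "norm (exp (v * x) / (1 + exp x)) \<le>
      norm (indicator {0..} x *\<^sub>R exp (- c * x) + indicator {0..} (0 + (- 1) * x) *\<^sub>R exp (- c * (0 + (- 1) * x)))"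
      proof (cases "x \<ge> 0")
        case True
        have "exp (v * x) / (1 + exp x) \<le> exp (v * x) / exp x"
          using pos by (intro divide_left_mono) auto
        also have "\<dots> = exp ((v - 1) * x)"
          by (simp add: exp_diff[symmetric] algebra_simps)
        also have "\<dots> \<le> exp (- c * x)"
          using mult_right_mono[of "v - 1" "- c" x] c True by simp
        finally show ?thesis
          using True pos by (auto simp: indicator_def)
      next
        case False
        have "exp (v * x) / (1 + exp x) \<le> exp (v * x) / 1"
          using pos by (intro divide_left_mono) auto
        also have "\<dots> \<le> exp (c * x)"
          using mult_right_mono_neg[of c v x] c False by simp
        finally show ?thesis
          using False pos by (auto simp: indicator_def)
      qed
    qed
  qed auto
qed

text \<open>
  Follows from
  \<open>|1 - r * exp (\<i> * t)|^2 = (1 + r)^2 * sin(t/2)^2 + (1 - r)^2 * cos(t/2)^2\<close>. It says that on a ray at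
  angle at least \<open>\<epsilon>\<close> from all zeros, \<open>1 - z/a_n\<close> is bounded below uniformly in \<open>n\<close>.
\<close>

lemma norm_one_minus_exp_ge:
  assumes "0 < \<epsilon>" "\<epsilon> \<le> Im y" "Im y \<le> 2 * pi - \<epsilon>"
  shows "norm (1 - exp y) \<ge> sin (\<epsilon> / 2) * (1 + exp (Re y))"
proof (rule power2_le_imp_le)
  have \<epsilon>: "\<epsilon> \<le> pi"
    using assms by simp
  have sin: "sin (\<epsilon> / 2) \<ge> 0"
    using \<epsilon> assms by (intro sin_ge_zero) auto
  have "sin (\<epsilon> / 2) \<le> sin (Im y / 2)"
  proof (cases "Im y \<le> pi")
    case True
    then show ?thesis
      using assms by (intro sin_monotone_2pi_le) auto
  next
    case False
    then have "sin (\<epsilon> / 2) \<le> sin (pi - Im y / 2)"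
      using assms by (intro sin_monotone_2pi_le) auto
    then show ?thesis
      by simp
  qed
  then have "(sin (\<epsilon> / 2))\<^sup>2 \<le> (sin (Im y / 2))\<^sup>2"
    using sin by (intro power_mono)
  then have "(sin (\<epsilon> / 2) * (1 + exp (Re y)))\<^sup>2 \<le> (sin (Im y / 2))\<^sup>2 * (1 + exp (Re y))\<^sup>2"
    by (simp add: power_mult_distrib mult_right_mono)
  also have "\<dots> \<le> (sin (Im y / 2))\<^sup>2 * (1 + exp (Re y))\<^sup>2 + (cos (Im y / 2))\<^sup>2 * (1 - exp (Re y))\<^sup>2"
    by simp
  also have "\<dots> = ((sin (Im y / 2))\<^sup>2 + (cos (Im y / 2))\<^sup>2) * (1 + (exp (Re y))\<^sup>2)
      - 2 * exp (Re y) * ((cos (Im y / 2))\<^sup>2 - (sin (Im y / 2))\<^sup>2)"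
    by algebra
  also have "\<dots> = (1 + (exp (Re y))\<^sup>2) - 2 * exp (Re y) * cos (2 * (Im y / 2))"
    unfolding cos_double sin_cos_squared_add by simp
  also have "\<dots> = (norm (1 - exp y))\<^sup>2"
  proof -
    have "(norm (1 - exp y))\<^sup>2 = (1 - exp (Re y) * cos (Im y))\<^sup>2 + (exp (Re y) * sin (Im y))\<^sup>2"
      by (simp add: cmod_power2 Re_exp Im_exp)
    also have "\<dots> = 1 - 2 * exp (Re y) * cos (Im y) + (exp (Re y))\<^sup>2 * ((sin (Im y))\<^sup>2 + (cos (Im y))\<^sup>2)"
      by algebra
    finally show ?thesis
      by simp
  qed
  finally show "(sin (\<epsilon> / 2) * (1 + exp (Re y)))\<^sup>2 \<le> (norm (1 - exp y))\<^sup>2" .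
qed simp

lemma contour_integral_horizontal:
  assumes "a < b"
  shows "contour_integral (linepath (Complex a t) (Complex b t)) f = integral {a..b} (\<lambda>x. f (Complex x t))"
proof -
  have "contour_integral (linepath (Complex a t) (Complex b t)) f =
      contour_integral (linepath (of_real a) (of_real b)) (\<lambda>z. f (z + \<i> * of_real t))"
    unfolding contour_integral_integral
  proof (intro integral_cong)
    fix x :: real
    have "linepath (Complex a t) (Complex b t) x = linepath (of_real a) (of_real b) x + \<i> * of_real t"
      by (simp add: linepath_def complex_eq_iff algebra_simps)
    moreover have "Complex b t - Complex a t = of_real b - of_real a"
      by (simp add: complex_eq_iff)
    ultimately show "f (linepath (Complex a t) (Complex b t) x) *
        vector_derivative (linepath (Complex a t) (Complex b t)) (at x) =
      f (linepath (of_real a) (of_real b) x + \<i> * of_real t) *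
        vector_derivative (linepath (complex_of_real a) (of_real b)) (at x)"
      by simp
  qed
  also have "\<dots> = integral {a..b} (\<lambda>x. f (of_real x + \<i> * of_real t))"
    using assms by (subst contour_integral_linepath_Reals_eq) auto
  also have "(\<lambda>x. f (of_real x + \<i> * of_real t)) = (\<lambda>x. f (Complex x t))"
    by (simp add: Complex_eq)
  finally show ?thesis .
qed

lemma exp_quotient_bound:
  assumes "0 < \<epsilon>" "\<epsilon> \<le> Im y" "Im y \<le> 2 * pi - \<epsilon>"
  shows "norm (exp (v * y) / (1 - exp y)) \<le> norm (exp (v * y)) / (sin (\<epsilon> / 2) * (1 + exp (Re y)))"
proof -
  have "sin (\<epsilon> / 2) > 0"
    using assms by (intro sin_gt_zero) auto
  then show ?thesis
    unfolding norm_divide using norm_one_minus_exp_ge[OF assms]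
    by (intro frac_le mult_pos_pos add_pos_pos) auto
qed

context
  fixes v :: complex and \<psi> :: real
  assumes v: "0 < Re v" "Re v < 1" and \<psi>: "0 < \<psi>" "\<psi> < 2 * pi"
begin

lemma exp_quotient_integrable:
  "integrable lborel (\<lambda>x. exp (v * Complex x \<psi>) / (1 - exp (Complex x \<psi>)))"
proof (rule Bochner_Integration.integrable_bound)
  define \<epsilon> where "\<epsilon> = min \<psi> (2 * pi - \<psi>)"
  have \<epsilon>: "\<epsilon> > 0" "\<epsilon> \<le> \<psi>" "\<psi> \<le> 2 * pi - \<epsilon>"
    using \<psi> by (auto simp: \<epsilon>_def)
  show "integrable lborel (\<lambda>x. (exp (- Im v * \<psi>) / sin (\<epsilon> / 2)) * (exp (Re v * x) / (1 + exp x)))"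
    using exp_ratio_integrable[OF v] by (rule integrable_mult_right)
  show "AE x in lborel. norm (exp (v * Complex x \<psi>) / (1 - exp (Complex x \<psi>))) \<le>
      norm ((exp (- Im v * \<psi>) / sin (\<epsilon> / 2)) * (exp (Re v * x) / (1 + exp x)))"
  proof (intro always_eventually allI)
    fix x :: real
    have "norm (exp (v * Complex x \<psi>) / (1 - exp (Complex x \<psi>))) \<le>
        norm (exp (v * Complex x \<psi>)) / (sin (\<epsilon> / 2) * (1 + exp x))"
      using exp_quotient_bound[of \<epsilon> "Complex x \<psi>" v] \<epsilon> by simp
    also have "\<dots> = (exp (- Im v * \<psi>) / sin (\<epsilon> / 2)) * (exp (Re v * x) / (1 + exp x))"
      by (simp add: exp_add[symmetric] exp_diff exp_minus divide_simps)
    finally show "norm (exp (v * Complex x \<psi>) / (1 - exp (Complex x \<psi>))) \<le>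
        norm ((exp (- Im v * \<psi>) / sin (\<epsilon> / 2)) * (exp (Re v * x) / (1 + exp x)))"
      by (metis abs_ge_self order_trans real_norm_def)
  qed
qed (simp add: Complex_eq)

text \<open>
  The integrand \<open>f(y) = exp (v * y) / (1 - exp y)\<close> satisfies
  \<open>f (y - 2 * pi * \<i>) = exp (- 2 * pi * \<i> * v) * f y\<close>, so the two horizontal sides of the rectangle
  with \<open>\<psi> - 2 * pi \<le> Im y \<le> \<psi>\<close> contribute multiples of one integral, while the vertical sides
  vanish in the limit because \<open>0 < Re v < 1\<close>. The only pole inside is \<open>0\<close>, with residue \<open>- 1\<close>.
\<close>

lemma exp_quotient_integral:
  "(1 - exp (- 2 * pi * \<i> * v)) * (LINT x|lborel. exp (v * Complex x \<psi>) / (1 - exp (Complex x \<psi>))) = 2 * pi * \<i>"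
proof -
  define f where "f = (\<lambda>y. exp (v * y) / (1 - exp y))"
  define S where "S = {y. - 2 * pi < Im y} \<inter> {y. Im y < 2 * pi}"
  define q where "q = exp (- 2 * pi * \<i> * v)"
  have S: "open S" "convex S" "0 \<in> S"
    unfolding S_def
    by (auto intro!: open_Int open_halfspace_Im_gt open_halfspace_Im_lt convex_Int convex_halfspace_Im_gt convex_halfspace_Im_lt)
  have nz: "exp y \<noteq> 1" if "y \<in> S - {0}" for y
  proof
    assume "exp y = 1"
    then obtain n :: int where n: "Re y = 0" "Im y = of_int (2 * n) * pi"
      by (auto simp: exp_eq_1)
    with that have "(- 1) * pi < real_of_int n * pi" "real_of_int n * pi < 1 * pi"
      by (auto simp: S_def mult.commute)
    then have "- 1 < real_of_int n" "real_of_int n < 1"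
      by (simp_all only: mult_less_cancel_right_pos[OF pi_gt_zero])
    then have "n = 0"
      by linarith
    with n that show False
      by (auto simp: complex_eq_iff)
  qed
  have holo: "f holomorphic_on S - {0}"
    unfolding f_def
  proof (intro holomorphic_intros)
    show "1 - exp y \<noteq> 0" if "y \<in> S - {0}" for y
      using nz[OF that] by simp
  qed
  have res: "residue f 0 = - 1"
  proof -
    have "residue (\<lambda>y. exp (v * y) / (1 - exp y)) 0 = exp (v * 0) / (- 1)"
      by (rule residue_simple_pole_deriv[of _ UNIV])
        (auto intro!: holomorphic_intros derivative_eq_intros connected_UNIV)
    then show ?thesis
      by (simp add: f_def)
  qed
  have shift: "f (Complex x (\<psi> - 2 * pi)) = q * f (Complex x \<psi>)" for x
  proof -
    have *: "Complex x (\<psi> - 2 * pi) = Complex x \<psi> + - (2 * of_real pi * \<i>)"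
      by (simp add: complex_eq_iff)
    have "exp (Complex x (\<psi> - 2 * pi)) = exp (Complex x \<psi>)"
      unfolding * exp_add exp_minus exp_two_pi_i by simp
    moreover have "exp (v * Complex x (\<psi> - 2 * pi)) = q * exp (v * Complex x \<psi>)"
      unfolding * q_def exp_add[symmetric] by (simp add: algebra_simps)
    ultimately show ?thesis
      by (simp add: f_def)
  qed
  define V where "V = (\<lambda>R. contour_integral (linepath (Complex R (\<psi> - 2 * pi)) (Complex R \<psi>)) f)"
  have contour: "(q - 1) * integral {-R..R} (\<lambda>x. f (Complex x \<psi>)) + (V R - V (- R)) = - 2 * pi * \<i>" if R: "R > 0" for R
  proof -
    define a1 a2 a3 a4 where "a1 = Complex (-R) (\<psi> - 2 * pi)" and "a2 = Complex R (\<psi> - 2 * pi)"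
      and "a3 = Complex R \<psi>" and "a4 = Complex (-R) \<psi>"
    have rect: "rectpath a1 a3 = linepath a1 a2 +++ linepath a2 a3 +++ linepath a3 a4 +++ linepath a4 a1"
      by (simp add: rectpath_def Let_def a1_def a2_def a3_def a4_def)
    have box0: "0 \<in> box a1 a3"
      using R \<psi> by (auto simp: in_box_complex_iff a1_def a3_def)
    have cboxS: "cbox a1 a3 \<subseteq> S"
      using \<psi> by (auto simp: in_cbox_complex_iff a1_def a3_def S_def)
    have img: "path_image (rectpath a1 a3) \<subseteq> S - {0}"
      using path_image_rectpath_cbox_minus_box[of a1 a3] R box0 cboxS by (auto simp: a1_def a3_def)
    have "contour_integral (rectpath a1 a3) f = 2 * pi * \<i> * (\<Sum>p\<in>{0}. winding_number (rectpath a1 a3) p * residue f p)"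
    proof (rule Residue_theorem[OF S(1) _ _ holo])
      show "\<forall>z. z \<notin> S \<longrightarrow> winding_number (rectpath a1 a3) z = 0"
        using cboxS R by (auto intro!: winding_number_rectpath_outside simp: a1_def a3_def)
    qed (use S img in \<open>auto intro: convex_connected\<close>)
    then have total: "contour_integral (rectpath a1 a3) f = - 2 * pi * \<i>"
      using winding_number_rectpath[OF box0] res by simp
    have int: "f contour_integrable_on linepath b c" if "path_image (linepath b c) \<subseteq> S - {0}" for b c
      using that S by (intro contour_integrable_holomorphic_simple[OF holo]) auto
    have imgs: "path_image (linepath a1 a2) \<subseteq> S - {0}" "path_image (linepath a2 a3) \<subseteq> S - {0}"
      "path_image (linepath a3 a4) \<subseteq> S - {0}" "path_image (linepath a4 a1) \<subseteq> S - {0}"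
      using img unfolding rect by (auto simp: path_image_join)
    have "contour_integral (rectpath a1 a3) f =
      contour_integral (linepath a1 a2) f + (contour_integral (linepath a2 a3) f +
      (contour_integral (linepath a3 a4) f + contour_integral (linepath a4 a1) f))"
      unfolding rect using imgs[THEN int] by (simp add: contour_integrable_joinI)
    also have "contour_integral (linepath a1 a2) f = q * integral {-R..R} (\<lambda>x. f (Complex x \<psi>))"
      unfolding a1_def a2_def using R by (simp add: contour_integral_horizontal shift)
    also have "contour_integral (linepath a3 a4) f = - integral {-R..R} (\<lambda>x. f (Complex x \<psi>))"
      using contour_integral_reversepath[of "linepath a4 a3" f] R
      by (simp add: a3_def a4_def contour_integral_horizontal)
    also have "contour_integral (linepath a4 a1) f = - V (- R)"
      using contour_integral_reversepath[of "linepath a1 a4" f]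
      by (simp add: a1_def a4_def V_def)
    also have "contour_integral (linepath a2 a3) f = V R"
      by (simp add: a2_def a3_def V_def)
    finally show ?thesis
      using total by (simp add: algebra_simps)
  qed
  define K where "K = exp (\<bar>Im v\<bar> * (2 * pi))"
  have V_bound: "norm (V R) \<le> K * exp (Re v * R) / \<bar>1 - exp R\<bar> * (2 * pi)" if "R \<noteq> 0" for R
  proof -
    have seg: "y \<in> S - {0} \<and> norm (f y) \<le> K * exp (Re v * R) / \<bar>1 - exp R\<bar>"
      if y: "y \<in> closed_segment (Complex R (\<psi> - 2 * pi)) (Complex R \<psi>)" for y
    proof -
      have y: "Re y = R" "\<psi> - 2 * pi \<le> Im y" "Im y \<le> \<psi>"
        using y by (auto simp: closed_segment_same_Re closed_segment_eq_real_ivl)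
      have "\<bar>1 - exp R\<bar> \<le> norm (1 - exp y)"
        using norm_triangle_ineq3[of 1 "exp y"] y by simp
      moreover have "norm (exp (v * y)) \<le> K * exp (Re v * R)"
      proof -
        have "- (Im v * Im y) \<le> \<bar>Im v\<bar> * \<bar>Im y\<bar>"
          by (metis abs_ge_minus_self abs_mult)
        also have "\<dots> \<le> \<bar>Im v\<bar> * (2 * pi)"
          using y \<psi> by (intro mult_left_mono) auto
        finally show ?thesis
          using y by (simp add: K_def exp_add[symmetric])
      qed
      ultimately have "norm (f y) \<le> K * exp (Re v * R) / \<bar>1 - exp R\<bar>"
        unfolding f_def norm_divide using \<open>R \<noteq> 0\<close> by (intro frac_le) (auto simp: K_def)
      then show ?thesis
        using y \<psi> \<open>R \<noteq> 0\<close> by (auto simp: S_def)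
    qed
    have "norm (V R) \<le> K * exp (Re v * R) / \<bar>1 - exp R\<bar> * norm (Complex R \<psi> - Complex R (\<psi> - 2 * pi))"
      unfolding V_def
    proof (rule contour_integral_bound_linepath)
      show "f contour_integrable_on linepath (Complex R (\<psi> - 2 * pi)) (Complex R \<psi>)"
        using seg S by (intro contour_integrable_holomorphic_simple[OF holo]) auto
    qed (use seg in \<open>auto simp: K_def\<close>)
    also have "norm (Complex R \<psi> - Complex R (\<psi> - 2 * pi)) = 2 * pi"
      by (simp add: complex_diff cmod_def real_sqrt_mult)
    finally show ?thesis .
  qed
  have V_top: "(V \<longlongrightarrow> 0) at_top"
  proof (rule Lim_null_comparison)
    show "eventually (\<lambda>R. norm (V R) \<le> K * exp (Re v * R) / \<bar>1 - exp R\<bar> * (2 * pi)) at_top"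
      using eventually_gt_at_top[of 0] by eventually_elim (rule V_bound, simp)
    show "((\<lambda>R. K * exp (Re v * R) / \<bar>1 - exp R\<bar> * (2 * pi)) \<longlongrightarrow> 0) at_top"
      using v by real_asymp
  qed
  have V_bot: "((\<lambda>R. V (- R)) \<longlongrightarrow> 0) at_top"
  proof (rule Lim_null_comparison)
    show "eventually (\<lambda>R. norm (V (- R)) \<le> K * exp (Re v * (- R)) / \<bar>1 - exp (- R)\<bar> * (2 * pi)) at_top"
      using eventually_gt_at_top[of 0] by eventually_elim (rule V_bound, simp)
    show "((\<lambda>R. K * exp (Re v * (- R)) / \<bar>1 - exp (- R)\<bar> * (2 * pi)) \<longlongrightarrow> 0) at_top"
      using v by real_asymp
  qed
  define I where "I = (LINT x|lborel. f (Complex x \<psi>))"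
  have intf: "integrable lborel (\<lambda>x. f (Complex x \<psi>))"
    using exp_quotient_integrable by (simp add: f_def)
  have lim: "(\<lambda>n. integral {- real n..real n} (\<lambda>x. f (Complex x \<psi>))) \<longlonglongrightarrow> I"
  proof -
    have "(\<lambda>n. LINT x|lborel. indicator {- real n..real n} x *\<^sub>R f (Complex x \<psi>)) \<longlonglongrightarrow> I"
      unfolding I_def
    proof (rule integral_dominated_convergence)
      show "integrable lborel (\<lambda>x. norm (f (Complex x \<psi>)))"
        using intf by (rule integrable_norm)
      show "AE x in lborel. (\<lambda>n. indicator {- real n..real n} x *\<^sub>R f (Complex x \<psi>)) \<longlonglongrightarrow> f (Complex x \<psi>)"
      proof (rule always_eventually, rule allI, rule tendsto_eventually)
        fix x :: real
        show "eventually (\<lambda>n. indicator {- real n..real n} x *\<^sub>R f (Complex x \<psi>) = f (Complex x \<psi>)) sequentially"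
          using eventually_ge_at_top[of "nat \<lceil>\<bar>x\<bar>\<rceil>"]
        proof eventually_elim
          case (elim n)
          then have "\<bar>x\<bar> \<le> real n"
            by linarith
          then have "x \<in> {- real n..real n}"
            by auto
          then show ?case by simp
        qed
      qed
    qed (use intf in \<open>auto simp: indicator_def\<close>)
    moreover have "(LINT x|lborel. indicator {- real n..real n} x *\<^sub>R f (Complex x \<psi>)) =
        integral {- real n..real n} (\<lambda>x. f (Complex x \<psi>))" for n
    proof -
      have "set_integrable lborel UNIV (\<lambda>x. f (Complex x \<psi>))"
        using intf by (simp add: set_integrable_def)
      then have "set_integrable lborel {- real n..real n} (\<lambda>x. f (Complex x \<psi>))"
        by (rule set_integrable_subset) auto
      then show ?thesis
        using set_borel_integral_eq_integral(2) by (auto simp: set_lebesgue_integral_def)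
    qed
    ultimately show ?thesis by simp
  qed
  have "(\<lambda>n. (q - 1) * integral {- real n..real n} (\<lambda>x. f (Complex x \<psi>)) + (V (real n) - V (- real n)))
      \<longlonglongrightarrow> (q - 1) * I + (0 - 0)"
    by (intro tendsto_intros lim filterlim_compose[OF V_top] filterlim_compose[OF V_bot] filterlim_real_sequentially)
  moreover have "eventually (\<lambda>n. (q - 1) * integral {- real n..real n} (\<lambda>x. f (Complex x \<psi>)) + (V (real n) - V (- real n))
      = - 2 * pi * \<i>) sequentially"
    using eventually_gt_at_top[of 0] by eventually_elim (rule contour, simp)
  ultimately have "(q - 1) * I + (0 - 0) = - 2 * pi * \<i>"
    by (rule LIMSEQ_unique[OF _ tendsto_eventually])
  then have "(1 - q) * I = 2 * pi * \<i>"
    by (simp add: algebra_simps)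
  then show ?thesis
    by (simp add: I_def f_def q_def)
qed

end

section \<open>Meromorphic functions near a pole\<close>

lemma nicely_meromorphic_removable:
  assumes Z: "Z nicely_meromorphic_on A" "\<beta> \<in> A" and H: "H analytic_on {\<beta>}"
    and eq: "eventually (\<lambda>s. Z s = H s) (at \<beta>)"
  shows "Z analytic_on {\<beta>}" "Z \<beta> = H \<beta>"
proof -
  have lim: "H \<midarrow>\<beta>\<rightarrow> H \<beta>"
    using analytic_at_imp_isCont[OF H] by (simp add: isCont_def)
  then have limZ: "Z \<midarrow>\<beta>\<rightarrow> H \<beta>"
    using eq by (metis (mono_tags, lifting) tendsto_cong)
  then have np: "\<not> is_pole Z \<beta>"
    by (meson at_neq_bot is_pole_def not_tendsto_and_filterlim_at_infinity)
  then show "Z analytic_on {\<beta>}"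
    using nicely_meromorphic_on_imp_analytic_at[OF Z] by simp
  then have "Z \<midarrow>\<beta>\<rightarrow> Z \<beta>"
    using analytic_at_imp_isCont isCont_def by blast
  with limZ show "Z \<beta> = H \<beta>"
    using LIM_unique by blast
qed

lemma pole_of_orderI:
  assumes Z: "Z nicely_meromorphic_on A" "\<beta> \<in> A" and H: "H analytic_on {\<beta>}"
    and eq: "eventually (\<lambda>s. Z s = H s / (s - \<beta>) ^ n) (at \<beta>)"
    and nz: "n > 0 \<Longrightarrow> H \<beta> \<noteq> 0"
  shows "pole_of_order Z \<beta> n"
proof (cases "n = 0")
  case True
  then show ?thesis
    using nicely_meromorphic_removable(1)[OF Z H] eq by (simp add: pole_of_order_def)
next
  case False
  have mero: "Z meromorphic_on {\<beta>}"
    using Z meromorphic_on_subset unfolding nicely_meromorphic_on_def by blast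
  obtain S where S: "open S" "\<beta> \<in> S" "H holomorphic_on S"
    using H by (auto simp: analytic_at)
  obtain T where T: "open T" "\<beta> \<in> T" "\<And>s. s \<in> T \<Longrightarrow> s \<noteq> \<beta> \<Longrightarrow> Z s = H s / (s - \<beta>) ^ n"
    using eq unfolding eventually_at_topological by blast
  have zord: "zorder Z \<beta> = - int n"
  proof (rule zorder_eqI)
    show "open (S \<inter> T)" "\<beta> \<in> S \<inter> T" "H holomorphic_on S \<inter> T" "H \<beta> \<noteq> 0"
      using S T nz False by (auto intro: holomorphic_on_subset)
    show "Z s = H s * (s - \<beta>) powi (- int n)" if "s \<in> S \<inter> T" "s \<noteq> \<beta>" for s
      using T(3)[of s] that by (simp add: power_int_minus divide_inverse)
  qed
  have "H \<midarrow>\<beta>\<rightarrow> H \<beta>"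
    using analytic_at_imp_isCont[OF H] by (simp add: isCont_def)
  then have "eventually (\<lambda>s. H s \<noteq> 0) (at \<beta>)"
    using nz False by (intro tendsto_imp_eventually_ne) auto
  moreover have "eventually (\<lambda>s. s \<noteq> \<beta>) (at \<beta>)"
    by (simp add: eventually_at_filter)
  ultimately have "eventually (\<lambda>s. Z s \<noteq> 0) (at \<beta>)"
    using eq by eventually_elim simp
  then have "is_pole Z \<beta>"
    using zorder_neg_imp_is_pole[OF mero] zord False by simp
  moreover have "isolated_singularity_at Z \<beta>"
    using mero by (simp add: meromorphic_at_iff)
  ultimately show ?thesis
    using zord False by (simp add: pole_of_order_def)
qed

text \<open>
  The difference of the two functions, with removable singularities filled in, is constant on \<open>A\<close>
  because it vanishes on \<open>B\<close>. Equality is concluded only near each point, as \<open>f\<close> and \<open>g\<close> may have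
  arbitrary values at poles and at removable singularities.
\<close>

lemma meromorphic_identity:
  assumes "f meromorphic_on A" "g meromorphic_on A" "open A" "connected A"
    and "open B" "B \<noteq> {}" "B \<subseteq> A" and eq: "\<And>z. z \<in> B \<Longrightarrow> f z = g z" and z: "z \<in> A"
  shows "eventually (\<lambda>w. f w = g w) (at z)"
proof -
  define D where "D = (\<lambda>w. f w - g w)"
  have D: "D meromorphic_on A"
    unfolding D_def using assms by (intro meromorphic_intros)
  have zero: "remove_sings D w = 0" if "w \<in> B" for w
  proof (rule remove_sings_eqI, rule tendsto_eventually)
    show "eventually (\<lambda>w. D w = 0) (at w)"
      using eventually_at_in_open'[OF \<open>open B\<close> that] by eventually_elim (simp add: D_def eq)
  qed
  have "remove_sings D constant_on A"
  proof (rule constant_on_extend_nicely_meromorphic_on)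
    show "remove_sings D nicely_meromorphic_on A"
      using D by (rule remove_sings_nicely_meromorphic)
    show "remove_sings D constant_on B"
      using zero by (auto simp: constant_on_def)
  qed (use assms in auto)
  then have zero_A: "\<And>w. w \<in> A \<Longrightarrow> remove_sings D w = 0"
    using zero assms(6,7) unfolding constant_on_def by (metis ex_in_conv subsetD)
  have "isolated_singularity_at D z"
    using D z by (metis meromorphic_on_altdef)
  then have "eventually (\<lambda>w. remove_sings D w = D w) (at z)"
    by (rule eventually_remove_sings_eq_at)
  moreover have "eventually (\<lambda>w. w \<in> A) (at z)"
    using assms z by (intro eventually_at_in_open')
  ultimately show ?thesis
  proof eventually_elim
    case (elim w)
    then have "D w = 0"
      by (simp add: zero_A)
    then show ?case
      by (simp add: D_def)
  qed
qed

text \<open>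
  Collects the terms of an expansion that have a pole at \<open>\<beta>0\<close> over the common denominator
  \<open>(s - \<beta>0)^(K + 1)\<close>. At \<open>\<beta>0\<close> only the terms with \<open>k i = K\<close> survive in the numerator \<open>Q\<close>.
\<close>

lemma principal_part_split:
  fixes I :: "'i set" and c \<beta> :: "'i \<Rightarrow> complex" and k :: "'i \<Rightarrow> nat"
  assumes fin: "finite I"
    and K: "\<And>i. i \<in> I \<Longrightarrow> \<beta> i = \<beta>0 \<Longrightarrow> c i \<noteq> 0 \<Longrightarrow> k i \<le> K"
  shows "\<exists>h Q. h analytic_on {\<beta>0} \<and> Q analytic_on {\<beta>0} \<and>
    Q \<beta>0 = fact K * (\<Sum>i | i \<in> I \<and> \<beta> i = \<beta>0 \<and> k i = K. c i) \<and>
    (\<forall>s. s \<noteq> \<beta>0 \<longrightarrow> (\<Sum>i\<in>I. c i * (laplace_numerator \<gamma> (k i) (s - \<beta> i) / (s - \<beta> i) ^ Suc (k i)))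
       = h s + Q s / (s - \<beta>0) ^ Suc K)"
proof -
  define J where "J = {i \<in> I. \<beta> i = \<beta>0 \<and> c i \<noteq> 0}"
  define J' where "J' = {i \<in> I. \<beta> i \<noteq> \<beta>0}"
  define h where "h = (\<lambda>s. \<Sum>i\<in>J'. c i * (laplace_numerator \<gamma> (k i) (s - \<beta> i) / (s - \<beta> i) ^ Suc (k i)))"
  define Q where "Q = (\<lambda>s. \<Sum>i\<in>J. c i * (laplace_numerator \<gamma> (k i) (s - \<beta>0) * (s - \<beta>0) ^ (K - k i)))"
  have num: "(\<lambda>s. laplace_numerator \<gamma> n (s - b)) analytic_on {\<beta>0}" for n b
    by (intro holomorphic_on_imp_analytic_at[of _ UNIV] holomorphic_intros) auto
  show ?thesis
  proof (intro exI conjI allI impI)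
    show "h analytic_on {\<beta>0}"
      unfolding h_def using num by (intro analytic_intros) (auto simp: J'_def)
    show "Q analytic_on {\<beta>0}"
      unfolding Q_def using num by (intro analytic_intros) auto
    show "Q \<beta>0 = fact K * (\<Sum>i | i \<in> I \<and> \<beta> i = \<beta>0 \<and> k i = K. c i)"
    proof -
      have "Q \<beta>0 = (\<Sum>i\<in>J. if k i = K then fact K * c i else 0)"
        unfolding Q_def
      proof (intro sum.cong refl)
        fix i assume "i \<in> J"
        then have "k i \<le> K"
          using K by (auto simp: J_def)
        then show "c i * (laplace_numerator \<gamma> (k i) (\<beta>0 - \<beta>0) * (\<beta>0 - \<beta>0) ^ (K - k i)) =
            (if k i = K then fact K * c i else 0)"
          by (auto simp: power_0_left)
      qed
      also have "\<dots> = (\<Sum>i\<in>{i \<in> J. k i = K}. fact K * c i)"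
        using fin by (subst sum.inter_filter) (auto simp: J_def)
      also have "\<dots> = (\<Sum>i | i \<in> I \<and> \<beta> i = \<beta>0 \<and> k i = K. fact K * c i)"
        using fin by (intro sum.mono_neutral_left) (auto simp: J_def)
      finally show ?thesis
        by (simp add: sum_distrib_left)
    qed
    fix s assume s: "s \<noteq> \<beta>0"
    let ?t = "\<lambda>i. c i * (laplace_numerator \<gamma> (k i) (s - \<beta> i) / (s - \<beta> i) ^ Suc (k i))"
    have "(\<Sum>i\<in>I. ?t i) = (\<Sum>i\<in>J' \<union> J. ?t i)"
      using fin by (intro sum.mono_neutral_right) (auto simp: J_def J'_def)
    also have "\<dots> = h s + (\<Sum>i\<in>J. ?t i)"
      unfolding h_def using fin by (intro sum.union_disjoint) (auto simp: J_def J'_def)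
    also have "(\<Sum>i\<in>J. ?t i) = Q s / (s - \<beta>0) ^ Suc K"
      unfolding Q_def sum_divide_distrib
    proof (rule sum.cong)
      fix i assume "i \<in> J"
      then have i: "\<beta> i = \<beta>0" "k i \<le> K"
        using K by (auto simp: J_def)
      then have "(s - \<beta>0) ^ Suc K = (s - \<beta>0) ^ Suc (k i) * (s - \<beta>0) ^ (K - k i)"
        by (simp add: power_add[symmetric])
      then show "?t i = c i * (laplace_numerator \<gamma> (k i) (s - \<beta>0) * (s - \<beta>0) ^ (K - k i)) / (s - \<beta>0) ^ Suc K"
        using s i by (simp del: power_Suc)
    qed simp
    finally show "(\<Sum>i\<in>I. ?t i) = h s + Q s / (s - \<beta>0) ^ Suc K" .
  qed
qed

section \<open>The zeta function as a Laplace integral\<close>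

text \<open>
  The zeros \<open>a_n\<close> enter through their logarithms \<open>b n\<close>, whose imaginary parts are the arguments in
  \<open>(\<Psi> - 2 * pi, \<Psi>)\<close> that define the powers; being outside the sector keeps them at distance at least
  \<open>\<epsilon>\<close> from both ends. The last assumption is \<open>\<Sum>n. |a_n|^(-\<sigma>) < \<infinity>\<close>.
\<close>

locale log_zeros =
  fixes b :: "nat \<Rightarrow> complex" and \<alpha> \<Psi> \<epsilon> :: real
  assumes eps: "\<epsilon> > 0" and alpha: "\<alpha> \<ge> 0"
    and Im_b: "\<And>n. \<Psi> - 2 * pi + \<epsilon> \<le> Im (b n)" "\<And>n. Im (b n) \<le> \<Psi> - \<epsilon>"
    and summable_b: "\<And>\<sigma>. \<sigma> > \<alpha> \<Longrightarrow> summable (\<lambda>n. exp (- \<sigma> * Re (b n)))"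
begin

abbreviation genus :: nat where "genus \<equiv> nat \<lfloor>\<alpha>\<rfloor>"

lemma genus: "real genus \<le> \<alpha>" "\<alpha> < real (Suc genus)"
  using alpha by linarith+

definition zeta :: "complex \<Rightarrow> complex" where
  "zeta s = (\<Sum>n. exp (- s * b n))"

text \<open>
  The quotient \<open>z / a_n\<close> at the point \<open>z = exp (x + \<i> * \<Psi>)\<close> of the ray.
\<close>

definition ratio :: "nat \<Rightarrow> real \<Rightarrow> complex" where
  "ratio n x = exp (Complex x \<Psi> - b n)"

text \<open>
  The derivative with respect to \<open>x\<close> of the logarithm of the Weierstrass factor at \<open>z / a_n\<close>,
  where again \<open>z = exp (x + \<i> * \<Psi>)\<close>.
\<close>

definition log_deriv_term :: "nat \<Rightarrow> real \<Rightarrow> complex" where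
  "log_deriv_term n x = - (ratio n x ^ Suc genus / (1 - ratio n x))"

definition log_deriv :: "real \<Rightarrow> complex" where
  "log_deriv x = (\<Sum>n. log_deriv_term n x)"

text \<open>
  This is \<open>exp (- \<i> * s * (\<Psi> - pi)) * sin (pi * s) / pi\<close>.
\<close>

definition reflection_factor :: "complex \<Rightarrow> complex" where
  "reflection_factor s = (exp (2 * pi * \<i> * s) - 1) * exp (- \<i> * s * \<Psi>) / (2 * pi * \<i>)"

lemma abs_Im_b: "\<bar>Im (b n)\<bar> \<le> \<bar>\<Psi>\<bar> + 2 * pi"
  using Im_b[of n] eps pi_gt_zero by linarith

lemma norm_exp_b_le:
  "norm (exp (- s * b n)) \<le> exp (\<bar>Im s\<bar> * (\<bar>\<Psi>\<bar> + 2 * pi)) * exp (- Re s * Re (b n))"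
proof -
  have "Im s * Im (b n) \<le> \<bar>Im s\<bar> * \<bar>Im (b n)\<bar>"
    by (metis abs_ge_self abs_mult)
  also have "\<dots> \<le> \<bar>Im s\<bar> * (\<bar>\<Psi>\<bar> + 2 * pi)"
    using abs_Im_b by (intro mult_left_mono) auto
  finally show ?thesis
    by (simp add: exp_add[symmetric])
qed

lemma zeta_sums:
  assumes "Re s > \<alpha>"
  shows "(\<lambda>n. exp (- s * b n)) sums zeta s"
proof -
  have "summable (\<lambda>n. exp (\<bar>Im s\<bar> * (\<bar>\<Psi>\<bar> + 2 * pi)) * exp (- Re s * Re (b n)))"
    using summable_b[OF assms] by (rule summable_mult)
  then have "summable (\<lambda>n. exp (- s * b n))"
    by (rule summable_comparison_test') (rule norm_exp_b_le)
  then show ?thesis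
    unfolding zeta_def by (rule summable_sums)
qed

text \<open>
  Some \<open>|a_n|\<close> may be less than 1, where \<open>|a_n|^(-Re s)\<close> increases with \<open>Re s\<close>; the majorant of the series
  on a disc is therefore the sum of the terms for the smallest and for the largest real part.
\<close>

lemma zeta_holomorphic: "zeta holomorphic_on {s. Re s > \<alpha>}"
proof (rule holomorphic_uniform_sequence)
  show "open {s. Re s > \<alpha>}"
    by (simp add: open_halfspace_Re_gt)
  show "(\<lambda>s. \<Sum>n<N. exp (- s * b n)) holomorphic_on {s. Re s > \<alpha>}" for N
    by (intro holomorphic_intros)
  fix s0 assume "s0 \<in> {s. Re s > \<alpha>}"
  then have s0: "Re s0 > \<alpha>" by simp
  define r where "r = (Re s0 - \<alpha>) / 2"
  have r: "r > 0" "Re s0 - r > \<alpha>"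
    using s0 by (auto simp: r_def field_simps)
  have near: "Re s0 - r \<le> Re s \<and> Re s \<le> Re s0 + r \<and> \<bar>Im s\<bar> \<le> \<bar>Im s0\<bar> + r" if "s \<in> cball s0 r" for s
  proof -
    have "norm (s0 - s) \<le> r"
      using that by (simp add: dist_norm)
    then have "\<bar>Re (s0 - s)\<bar> \<le> r" "\<bar>Im (s0 - s)\<bar> \<le> r"
      using abs_Re_le_cmod abs_Im_le_cmod order_trans by blast+
    then show ?thesis by auto
  qed
  define M where "M = exp ((\<bar>Im s0\<bar> + r) * (\<bar>\<Psi>\<bar> + 2 * pi))"
  have "uniform_limit (cball s0 r) (\<lambda>N s. \<Sum>n<N. exp (- s * b n)) (\<lambda>s. \<Sum>n. exp (- s * b n)) sequentially"
  proof (rule Weierstrass_m_test)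
    show "summable (\<lambda>n. M * (exp (- (Re s0 - r) * Re (b n)) + exp (- (Re s0 + r) * Re (b n))))"
      using r by (intro summable_mult summable_add summable_b) auto
    fix n s assume "s \<in> cball s0 r"
    note s = near[OF this]
    have "norm (exp (- s * b n)) \<le> exp (\<bar>Im s\<bar> * (\<bar>\<Psi>\<bar> + 2 * pi)) * exp (- Re s * Re (b n))"
      by (rule norm_exp_b_le)
    also have "\<dots> \<le> M * (exp (- (Re s0 - r) * Re (b n)) + exp (- (Re s0 + r) * Re (b n)))"
    proof (rule mult_mono)
      show "exp (\<bar>Im s\<bar> * (\<bar>\<Psi>\<bar> + 2 * pi)) \<le> M"
        unfolding M_def using s by (intro exp_mono mult_right_mono) auto
      show "exp (- Re s * Re (b n)) \<le> exp (- (Re s0 - r) * Re (b n)) + exp (- (Re s0 + r) * Re (b n))"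
      proof (cases "Re (b n) \<ge> 0")
        case True
        then have "exp (- Re s * Re (b n)) \<le> exp (- (Re s0 - r) * Re (b n))"
          using s mult_right_mono[of "Re s0 - r" "Re s" "Re (b n)"] by (simp add: algebra_simps)
        then show ?thesis
          by (simp add: add_increasing2)
      next
        case False
        then have "exp (- Re s * Re (b n)) \<le> exp (- (Re s0 + r) * Re (b n))"
          using s mult_right_mono_neg[of "Re s" "Re s0 + r" "Re (b n)"] by (simp add: algebra_simps)
        then show ?thesis
          by (simp add: add_increasing)
      qed
    qed (auto simp: M_def)
    finally show "norm (exp (- s * b n)) \<le> M * (exp (- (Re s0 - r) * Re (b n)) + exp (- (Re s0 + r) * Re (b n)))" .
  qed
  moreover have "cball s0 r \<subseteq> {s. Re s > \<alpha>}"
    using near r by fastforce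
  ultimately show "\<exists>d>0. cball s0 d \<subseteq> {s. Re s > \<alpha>} \<and>
      uniform_limit (cball s0 d) (\<lambda>N s. \<Sum>n<N. exp (- s * b n)) zeta sequentially"
    using r unfolding zeta_def[abs_def] by blast
qed

lemma sin_eps_pos: "sin (\<epsilon> / 2) > 0"
proof -
  have "\<epsilon> \<le> pi"
    using Im_b[of 0] by linarith
  then show ?thesis
    using eps by (intro sin_gt_zero) auto
qed

lemma log_deriv_term_eq:
  "log_deriv_term n x = - (exp (of_nat (Suc genus) * (Complex x \<Psi> - b n)) / (1 - exp (Complex x \<Psi> - b n)))"
  by (simp only: log_deriv_term_def ratio_def exp_of_nat_mult)

lemma log_deriv_term_bound:
  "norm (log_deriv_term n x) \<le>
    exp (real (Suc genus) * (x - Re (b n))) / (sin (\<epsilon> / 2) * (1 + exp (x - Re (b n))))"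
proof -
  have "norm (log_deriv_term n x) \<le> norm (exp (of_nat (Suc genus) * (Complex x \<Psi> - b n))) /
      (sin (\<epsilon> / 2) * (1 + exp (Re (Complex x \<Psi> - b n))))"
    unfolding log_deriv_term_eq norm_minus_cancel
    using eps Im_b[of n] by (intro exp_quotient_bound) auto
  then show ?thesis
    by (simp del: of_nat_Suc)
qed

lemma log_deriv_term_bound':
  "norm (log_deriv_term n x) \<le>
    exp (real (Suc genus) * x) / sin (\<epsilon> / 2) * exp (- real (Suc genus) * Re (b n))"
proof -
  have "exp (real (Suc genus) * (x - Re (b n))) / (sin (\<epsilon> / 2) * (1 + exp (x - Re (b n)))) \<le>
      exp (real (Suc genus) * (x - Re (b n))) / (sin (\<epsilon> / 2) * 1)"
    using sin_eps_pos by (intro divide_left_mono mult_left_mono mult_pos_pos add_pos_pos) auto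
  also have "\<dots> = exp (real (Suc genus) * x) / sin (\<epsilon> / 2) * exp (- real (Suc genus) * Re (b n))"
    by (simp add: exp_add[symmetric] algebra_simps del: of_nat_Suc)
  finally show ?thesis
    using log_deriv_term_bound order_trans by blast
qed

lemma log_deriv_term_summable: "summable (\<lambda>n. norm (log_deriv_term n x))"
proof (rule summable_comparison_test')
  show "summable (\<lambda>n. exp (real (Suc genus) * x) / sin (\<epsilon> / 2) * exp (- real (Suc genus) * Re (b n)))"
    using genus(2) by (intro summable_mult summable_b)
qed (use log_deriv_term_bound' in simp)

text \<open>
  Dropping \<open>1 + exp (x - Re (b n))\<close> from the denominator costs nothing as \<open>x\<close> tends to \<open>- \<infinity>\<close>, and there
  the bound gives convergence of the Laplace integral for all \<open>Re s < \<lfloor>\<alpha>\<rfloor> + 1\<close>.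
\<close>

lemma log_deriv_bound:
  obtains C where "\<And>x. norm (log_deriv x) \<le> C * exp (real (Suc genus) * x)"
proof
  fix x
  define C where "C = (\<Sum>n. exp (- real (Suc genus) * Re (b n))) / sin (\<epsilon> / 2)"
  have sb: "summable (\<lambda>n. exp (- real (Suc genus) * Re (b n)))"
    using genus(2) by (intro summable_b)
  have "norm (log_deriv x) \<le> (\<Sum>n. norm (log_deriv_term n x))"
    unfolding log_deriv_def by (rule summable_norm[OF log_deriv_term_summable])
  also have "\<dots> \<le> (\<Sum>n. exp (real (Suc genus) * x) / sin (\<epsilon> / 2) * exp (- real (Suc genus) * Re (b n)))"
    by (intro suminf_le log_deriv_term_bound' log_deriv_term_summable summable_mult sb)
  also have "\<dots> = C * exp (real (Suc genus) * x)"
    by (subst suminf_mult[OF sb]) (simp add: C_def)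
  finally show "norm (log_deriv x) \<le> ((\<Sum>n. exp (- real (Suc genus) * Re (b n))) / sin (\<epsilon> / 2)) * exp (real (Suc genus) * x)"
    by (simp add: C_def)
qed

context
  fixes s :: complex
  assumes s: "\<alpha> < Re s" "Re s < real (Suc genus)"
begin

text \<open>
  The translation by \<open>Re (b n)\<close> turns the integral into the one over the line \<open>Im y = \<Psi> - Im (b n)\<close>, with
  \<open>v = \<lfloor>\<alpha>\<rfloor> + 1 - s\<close>.
\<close>

lemma mellin_term:
  shows mellin_term_integrable: "integrable lborel (\<lambda>x. exp (- s * of_real x) * log_deriv_term n x)"
    and mellin_term_integral:
      "reflection_factor s * (LINT x|lborel. exp (- s * of_real x) * log_deriv_term n x) = exp (- s * b n)"
proof -
  define \<psi> where "\<psi> = \<Psi> - Im (b n)"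
  define v where "v = of_nat (Suc genus) - s"
  define g where "g = (\<lambda>x. exp (v * Complex x \<psi>) / (1 - exp (Complex x \<psi>)))"
  define f where "f = (\<lambda>x. exp (- s * of_real x) * log_deriv_term n x)"
  define c where "c = - exp (- s * b n + \<i> * s * \<Psi>)"
  have v: "0 < Re v" "Re v < 1"
    using s genus by (auto simp: v_def)
  have \<psi>: "0 < \<psi>" "\<psi> < 2 * pi"
    using Im_b[of n] eps by (auto simp: \<psi>_def)
  have f_eq: "f (Re (b n) + 1 * x) = c * g x" for x
  proof -
    define y where "y = Complex x \<psi>"
    have y: "Complex (Re (b n) + 1 * x) \<Psi> - b n = y"
      by (simp add: y_def \<psi>_def complex_eq_iff)
    have x: "of_real (Re (b n) + 1 * x) = y + b n - \<i> * \<Psi>"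
      by (simp add: y_def \<psi>_def complex_eq_iff)
    have "f (Re (b n) + 1 * x) = - (exp (- s * (y + b n - \<i> * \<Psi>)) * exp (of_nat (Suc genus) * y) / (1 - exp y))"
      unfolding f_def log_deriv_term_eq x y by simp
    also have "exp (- s * (y + b n - \<i> * \<Psi>)) * exp (of_nat (Suc genus) * y) = exp (- s * b n + \<i> * s * \<Psi>) * exp (v * y)"
      unfolding exp_add[symmetric] v_def by (simp add: algebra_simps)
    finally show ?thesis
      by (simp add: c_def g_def y_def)
  qed
  have g_int: "integrable lborel g"
    unfolding g_def by (rule exp_quotient_integrable[OF v \<psi>])
  then have "integrable lborel (\<lambda>x. f (Re (b n) + 1 * x))"
    unfolding f_eq by (rule integrable_mult_right)
  then show "integrable lborel f"
    using lborel_integrable_real_affine_iff[of 1 f "Re (b n)"] by simp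
  have "(LINT x|lborel. f x) = (LINT x|lborel. f (Re (b n) + 1 * x))"
    using lborel_integral_real_affine[of 1 f "Re (b n)"] by simp
  also have "\<dots> = c * (LINT x|lborel. g x)"
    unfolding f_eq by simp
  finally have int: "(LINT x|lborel. f x) = c * (LINT x|lborel. g x)" .
  have "exp (- 2 * pi * \<i> * v) = exp (2 * pi * \<i> * s)"
  proof -
    have "exp (- 2 * pi * \<i> * v) = exp (2 * pi * \<i> * s) * exp (- (of_nat (Suc genus) * (2 * pi * \<i>)))"
      unfolding exp_add[symmetric] v_def by (simp add: algebra_simps)
    also have "exp (- (of_nat (Suc genus) * (2 * pi * \<i>))) = inverse (exp (2 * pi * \<i>) ^ Suc genus)"
      unfolding exp_minus exp_of_nat_mult ..
    finally show ?thesis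
      by simp
  qed
  then have kernel: "(1 - exp (2 * pi * \<i> * s)) * (LINT x|lborel. g x) = 2 * pi * \<i>"
    using exp_quotient_integral[OF v \<psi>] by (simp add: g_def)
  have "exp (- \<i> * s * \<Psi>) * c = - exp (- s * b n)"
    unfolding c_def mult_minus_right exp_add[symmetric] by simp
  then have "reflection_factor s * (c * (LINT x|lborel. g x)) =
      exp (- s * b n) * ((1 - exp (2 * pi * \<i> * s)) * (LINT x|lborel. g x)) / (2 * pi * \<i>)"
  proof -
    have "reflection_factor s * (c * (LINT x|lborel. g x)) =
        (exp (2 * pi * \<i> * s) - 1) * (exp (- \<i> * s * \<Psi>) * c) * (LINT x|lborel. g x) / (2 * pi * \<i>)"
      by (simp add: reflection_factor_def)
    then show ?thesis
      unfolding \<open>exp (- \<i> * s * \<Psi>) * c = - exp (- s * b n)\<close> by (simp add: algebra_simps)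
  qed
  also have "\<dots> = exp (- s * b n)"
    unfolding kernel by simp
  finally show "reflection_factor s * (LINT x|lborel. f x) = exp (- s * b n)"
    unfolding int .
qed

text \<open>
  After the same translation the modulus of the integrand has a bound that depends on \<open>n\<close> only
  through the factor \<open>|a_n|^(- Re s)\<close>; this is what permits summation under the integral.
\<close>

lemma mellin_term_norm_integral:
  obtains K where "\<And>n. (LINT x|lborel. norm (exp (- s * of_real x) * log_deriv_term n x)) \<le> K * exp (- Re s * Re (b n))"
proof
  fix n
  define \<upsilon> where "\<upsilon> = real (Suc genus) - Re s"
  define h where "h = (\<lambda>x. exp (\<upsilon> * x) / (1 + exp x))"
  have h: "integrable lborel h"
    unfolding h_def using s genus by (intro exp_ratio_integrable) (auto simp: \<upsilon>_def)
  then have h': "integrable lborel (\<lambda>x. h (- Re (b n) + 1 * x))"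
    by (intro lborel_integrable_real_affine) auto
  have "(LINT x|lborel. norm (exp (- s * of_real x) * log_deriv_term n x)) \<le>
      (LINT x|lborel. exp (- Re s * Re (b n)) / sin (\<epsilon> / 2) * h (- Re (b n) + 1 * x))"
  proof (rule integral_mono)
    show "integrable lborel (\<lambda>x. norm (exp (- s * of_real x) * log_deriv_term n x))"
      by (rule integrable_norm[OF mellin_term_integrable])
    show "integrable lborel (\<lambda>x. exp (- Re s * Re (b n)) / sin (\<epsilon> / 2) * h (- Re (b n) + 1 * x))"
      using h' by (rule integrable_mult_right)
    fix x
    have "norm (exp (- s * of_real x) * log_deriv_term n x) \<le> exp (- Re s * x) *
        (exp (real (Suc genus) * (x - Re (b n))) / (sin (\<epsilon> / 2) * (1 + exp (x - Re (b n)))))"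
      unfolding norm_mult using log_deriv_term_bound by (intro mult_mono) auto
    also have "\<dots> = (exp (- Re s * x) * exp (real (Suc genus) * (x - Re (b n)))) / (sin (\<epsilon> / 2) * (1 + exp (x - Re (b n))))"
      by simp
    also have "exp (- Re s * x) * exp (real (Suc genus) * (x - Re (b n))) =
        exp (- Re s * Re (b n)) * exp (\<upsilon> * (x - Re (b n)))"
      unfolding exp_add[symmetric] \<upsilon>_def by (simp add: algebra_simps del: of_nat_Suc)
    finally show "norm (exp (- s * of_real x) * log_deriv_term n x) \<le>
        exp (- Re s * Re (b n)) / sin (\<epsilon> / 2) * h (- Re (b n) + 1 * x)"
      by (simp add: h_def)
  qed
  also have "\<dots> = exp (- Re s * Re (b n)) / sin (\<epsilon> / 2) * (LINT x|lborel. h x)"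
    using lborel_integral_real_affine[of 1 h "- Re (b n)"] by simp
  finally show "(LINT x|lborel. norm (exp (- s * of_real x) * log_deriv_term n x)) \<le>
      (LINT x|lborel. exp ((real (Suc genus) - Re s) * x) / (1 + exp x)) / sin (\<epsilon> / 2) * exp (- Re s * Re (b n))"
    by (simp add: h_def \<upsilon>_def mult.commute)
qed

text \<open>
  The strip is the overlap of two conditions: \<open>\<alpha> < Re s\<close> makes the sum over the zeros converge, and
  \<open>Re s < \<lfloor>\<alpha>\<rfloor> + 1\<close> makes the integral of each term converge at \<open>- \<infinity>\<close>. The strip is never empty.
\<close>

lemma zeta_eq_mellin:
  shows mellin_integrable: "integrable lborel (\<lambda>x. exp (- s * of_real x) * log_deriv x)"
    and zeta_mellin: "zeta s = reflection_factor s * (LINT x|lborel. exp (- s * of_real x) * log_deriv x)"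
proof -
  define f where "f = (\<lambda>n x. exp (- s * of_real x) * log_deriv_term n x)"
  have sum_eq: "(\<Sum>n. f n x) = exp (- s * of_real x) * log_deriv x" for x
    unfolding f_def log_deriv_def
    by (rule suminf_mult[OF summable_norm_cancel[OF log_deriv_term_summable]])
  obtain K where K: "\<And>n. (LINT x|lborel. norm (f n x)) \<le> K * exp (- Re s * Re (b n))"
    unfolding f_def using mellin_term_norm_integral by blast
  have 1: "integrable lborel (f n)" for n
    unfolding f_def by (rule mellin_term_integrable)
  have 2: "AE x in lborel. summable (\<lambda>n. norm (f n x))"
    unfolding f_def norm_mult by (intro always_eventually allI summable_mult log_deriv_term_summable)
  have 3: "summable (\<lambda>n. LINT x|lborel. norm (f n x))"
  proof (rule summable_comparison_test')
    show "summable (\<lambda>n. K * exp (- Re s * Re (b n)))"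
      using s by (intro summable_mult summable_b)
  qed (use K in \<open>simp add: integral_nonneg_AE\<close>)
  show "integrable lborel (\<lambda>x. exp (- s * of_real x) * log_deriv x)"
    using integrable_suminf[OF 1 2 3] unfolding sum_eq .
  have "(\<lambda>n. integral\<^sup>L lborel (f n)) sums (LINT x|lborel. exp (- s * of_real x) * log_deriv x)"
    using sums_integral[OF 1 2 3] unfolding sum_eq .
  then have "(\<lambda>n. reflection_factor s * integral\<^sup>L lborel (f n)) sums
      (reflection_factor s * (LINT x|lborel. exp (- s * of_real x) * log_deriv x))"
    by (rule sums_mult)
  also have "(\<lambda>n. reflection_factor s * integral\<^sup>L lborel (f n)) = (\<lambda>n. exp (- s * b n))"
    unfolding f_def by (intro ext mellin_term_integral)
  finally show "zeta s = reflection_factor s * (LINT x|lborel. exp (- s * of_real x) * log_deriv x)"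
    using zeta_sums[OF s(1)] sums_unique2 by blast
qed

end

end

section \<open>Continuation of the zeta function by an expansion\<close>

lemma (in log_zeros) reflection_factor_holomorphic: "reflection_factor holomorphic_on A"
  unfolding reflection_factor_def[abs_def] by (intro holomorphic_intros) auto

lemma (in log_zeros) reflection_factor_integer:
  fixes n :: int
  obtains U where "U holomorphic_on UNIV" "U (of_int n) = exp (- \<i> * of_int n * \<Psi>)"
    "\<And>s. reflection_factor s = (s - of_int n) * U s"
proof -
  (* The difference quotient at the zero n, with its removable singularity filled in. *)
  define U where "U = (\<lambda>s. if s = of_int n then deriv reflection_factor (of_int n)
    else (reflection_factor s - reflection_factor (of_int n)) / (s - of_int n))"
  have one: "exp (2 * pi * \<i> * of_int n) = 1"
    unfolding exp_eq_1 by (auto intro!: exI[of _ n])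
  then have zero: "reflection_factor (of_int n) = 0"
    by (simp add: reflection_factor_def)
  have "(reflection_factor has_field_derivative exp (- \<i> * of_int n * \<Psi>)) (at (of_int n))"
    unfolding reflection_factor_def[abs_def]
    by ((rule derivative_eq_intros refl)+, simp, unfold one, simp)
  then have der: "deriv reflection_factor (of_int n) = exp (- \<i> * of_int n * \<Psi>)"
    by (rule DERIV_imp_deriv)
  show thesis
  proof
    show "U holomorphic_on UNIV"
      unfolding U_def by (rule pole_lemma[OF reflection_factor_holomorphic]) auto
  qed (auto simp: U_def der zero)
qed

lemma (in log_zeros) reflection_factor_nonzero:
  assumes "x \<notin> \<int>"
  shows "reflection_factor (of_real x) \<noteq> 0"
proof -
  have "exp (2 * pi * \<i> * of_real x) \<noteq> 1"
  proof
    assume "exp (2 * pi * \<i> * of_real x) = 1"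
    then obtain n :: int where "2 * pi * x = of_int (2 * n) * pi"
      by (auto simp: exp_eq_1)
    then have "x = of_int n"
      by simp
    with assms show False
      by simp
  qed
  then show ?thesis
    by (simp add: reflection_factor_def)
qed

text \<open>
  Here \<open>lam\<close> is \<open>ln F - \<omega>\<close> along the ray as a function of \<open>x\<close>. The expansion is indexed by an arbitrary
  finite set, so that the terms of the expansion of \<open>ln F\<close> and the monomials of \<open>\<omega>\<close> can be treated
  alike.
\<close>

locale log_zeros_expansion = log_zeros +
  fixes lam R :: "real \<Rightarrow> complex" and I :: "'i set" and c :: "'i \<Rightarrow> complex"
    and k :: "'i \<Rightarrow> nat" and \<beta> :: "'i \<Rightarrow> complex" and \<sigma> C :: real
  assumes lam_deriv: "\<And>x. (lam has_vector_derivative log_deriv x) (at x)"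
    and log_deriv_cont: "continuous_on UNIV log_deriv"
    and finite_I: "finite I" and Re_\<beta>: "\<And>i. i \<in> I \<Longrightarrow> Re (\<beta> i) \<le> \<alpha>" and sigma: "\<sigma> < \<alpha>"
    and R_cont: "continuous_on {0..} R" and R_bound: "\<And>x. x \<ge> 0 \<Longrightarrow> norm (R x) \<le> C * exp (\<sigma> * x)"
    and lam_eq: "\<And>x. x \<ge> 0 \<Longrightarrow> lam x = (\<Sum>i\<in>I. c i * ((of_real x + \<i> * \<Psi>) ^ k i * exp (\<beta> i * of_real x))) + R x"
begin

definition principal_sum :: "complex \<Rightarrow> complex" where
  "principal_sum s = (\<Sum>i\<in>I. c i * (laplace_numerator (\<i> * \<Psi>) (k i) (s - \<beta> i) / (s - \<beta> i) ^ Suc (k i)))"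

text \<open>
  The integral over \<open>x < 0\<close>, reflected to the half-line \<open>x > 0\<close>, together with the boundary term of the
  integration by parts on \<open>x > 0\<close>.
\<close>

definition near_part :: "complex \<Rightarrow> complex" where
  "near_part s = laplace (\<lambda>x. log_deriv (- x)) (- s) - lam 0"

definition continuation :: "complex \<Rightarrow> complex" where
  "continuation s = reflection_factor s * (near_part s + s * (principal_sum s + laplace R s))"

definition strip :: "complex set" where
  "strip = {s. \<sigma> < Re s} \<inter> {s. Re s < real (Suc genus)}"

lemma open_strip: "open strip"
  unfolding strip_def by (intro open_Int open_halfspace_Re_gt open_halfspace_Re_lt)

lemma near_part_holomorphic: "near_part holomorphic_on {s. Re s < real (Suc genus)}"
proof -
  obtain C where C: "\<And>x. norm (log_deriv x) \<le> C * exp (real (Suc genus) * x)"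
    using log_deriv_bound by blast
  have "laplace (\<lambda>x. log_deriv (- x)) holomorphic_on {s. Re s > - real (Suc genus)}"
  proof (rule laplace_holomorphic)
    show "continuous_on {0..} (\<lambda>x. log_deriv (- x))"
      by (intro continuous_on_compose2[OF log_deriv_cont] continuous_intros) auto
    show "norm (log_deriv (- x)) \<le> C * exp (- real (Suc genus) * x)" for x
      using C[of "- x"] by (simp add: algebra_simps)
  qed
  then have "(laplace (\<lambda>x. log_deriv (- x)) \<circ> uminus) holomorphic_on {s. Re s < real (Suc genus)}"
    by (rule holomorphic_on_compose_gen[rotated]) (auto intro!: holomorphic_intros)
  then show ?thesis
    unfolding near_part_def[abs_def] o_def by (intro holomorphic_intros)
qed

lemma laplace_R_holomorphic: "laplace R holomorphic_on {s. Re s > \<sigma>}"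
  by (rule laplace_holomorphic[OF R_cont R_bound])

lemma continuation_meromorphic: "continuation meromorphic_on strip"
proof -
  have "near_part analytic_on strip"
    using holomorphic_on_subset[OF near_part_holomorphic] open_strip
    by (simp add: analytic_on_open strip_def)
  moreover have "laplace R analytic_on strip"
    using holomorphic_on_subset[OF laplace_R_holomorphic] open_strip
    by (simp add: analytic_on_open strip_def)
  moreover have "reflection_factor analytic_on strip"
    using reflection_factor_holomorphic open_strip by (simp add: analytic_on_open)
  moreover have "(\<lambda>s. laplace_numerator (\<i> * \<Psi>) n (s - b)) analytic_on strip" for n b
    using open_strip by (simp add: analytic_on_open) (intro holomorphic_intros)
  ultimately show ?thesis
    unfolding continuation_def[abs_def] principal_sum_def
    by (intro meromorphic_intros analytic_on_imp_meromorphic_on) 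
qed

lemma laplace_lam:
  assumes s: "Re s > \<alpha>"
  shows "laplace lam s = principal_sum s + laplace R s"
proof -
  define f where "f = (\<lambda>i x. exp (- s * of_real x) * ((of_real x + \<i> * \<Psi>) ^ k i * exp (\<beta> i * of_real x)))"
  have int_f: "set_integrable lborel {0..} (f i)" if "i \<in> I" for i
    unfolding f_def by (rule laplace_polynomial_exponential_integrable) (use s Re_\<beta>[OF that] in auto)
  then have int: "set_integrable lborel {0..} (\<lambda>x. c i * f i x)" if "i \<in> I" for i
    using that by (intro set_integrable_mult_right) auto
  have int_R: "set_integrable lborel {0..} (\<lambda>x. exp (- s * of_real x) * R x)"
    using s sigma by (intro laplace_integrable[OF R_cont R_bound]) auto
  have int_sum: "set_integrable lborel {0..} (\<lambda>x. \<Sum>i\<in>I. c i * f i x)"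
    using int unfolding set_integrable_def scaleR_sum_right by (intro Bochner_Integration.integrable_sum)
  have "laplace lam s = (LINT x:{0..}|lborel. (\<Sum>i\<in>I. c i * f i x) + exp (- s * of_real x) * R x)"
    unfolding laplace_def
    by (intro set_lebesgue_integral_cong) (auto simp: lam_eq f_def sum_distrib_left algebra_simps)
  also have "\<dots> = (LINT x:{0..}|lborel. \<Sum>i\<in>I. c i * f i x) + laplace R s"
    using int_sum int_R by (simp add: laplace_def)
  also have "(LINT x:{0..}|lborel. \<Sum>i\<in>I. c i * f i x) = (\<Sum>i\<in>I. LINT x:{0..}|lborel. c i * f i x)"
    using int unfolding set_integrable_def set_lebesgue_integral_def scaleR_sum_right
    by (intro Bochner_Integration.integral_sum)
  also have "\<dots> = principal_sum s"
    unfolding principal_sum_def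
  proof (intro sum.cong refl)
    fix i assume "i \<in> I"
    then show "(LINT x:{0..}|lborel. c i * f i x) =
        c i * (laplace_numerator (\<i> * \<Psi>) (k i) (s - \<beta> i) / (s - \<beta> i) ^ Suc (k i))"
      using laplace_polynomial_exponential[of "\<beta> i" s "\<i> * \<Psi>" "k i"] s Re_\<beta>[of i]
      by (simp add: laplace_def f_def)
  qed
  finally show ?thesis .
qed

lemma lam_bound:
  assumes "\<eta> > \<alpha>"
  obtains D where "\<And>x. x \<ge> 0 \<Longrightarrow> norm (lam x) \<le> D * exp (\<eta> * x)"
proof -
  have "\<exists>D. \<forall>x\<ge>0. norm ((of_real x + \<i> * \<Psi>) ^ k i * exp (\<beta> i * of_real x)) \<le> D * exp (\<eta> * x)" if "i \<in> I" for i
    using polynomial_exponential_bound[of "\<beta> i" \<eta> "\<i> * \<Psi>" "k i"] Re_\<beta>[OF that] assms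
    by (metis order_le_less_trans)
  then obtain D where D: "\<And>i x. i \<in> I \<Longrightarrow> x \<ge> 0 \<Longrightarrow>
      norm ((of_real x + \<i> * \<Psi>) ^ k i * exp (\<beta> i * of_real x)) \<le> D i * exp (\<eta> * x)"
    by metis
  show thesis
  proof
    fix x :: real assume x: "x \<ge> 0"
    have C: "C \<ge> 0"
      using R_bound[of 0] norm_ge_zero[of "R 0"] by (simp del: norm_ge_zero)
    have "norm (lam x) \<le> (\<Sum>i\<in>I. norm (c i) * (D i * exp (\<eta> * x))) + C * exp (\<eta> * x)"
      unfolding lam_eq[OF x]
    proof (intro norm_triangle_le add_mono sum_norm_le)
      show "norm (c i * ((of_real x + \<i> * \<Psi>) ^ k i * exp (\<beta> i * of_real x))) \<le> norm (c i) * (D i * exp (\<eta> * x))"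
        if "i \<in> I" for i
        using D[OF that x] by (simp add: norm_mult mult_left_mono)
      have "norm (R x) \<le> C * exp (\<sigma> * x)"
        by (rule R_bound[OF x])
      also have "\<dots> \<le> C * exp (\<eta> * x)"
        using C x assms sigma by (intro mult_left_mono exp_mono mult_right_mono) auto
      finally show "norm (R x) \<le> C * exp (\<eta> * x)" .
    qed
    then show "norm (lam x) \<le> ((\<Sum>i\<in>I. norm (c i) * D i) + C) * exp (\<eta> * x)"
      by (simp add: sum_distrib_left sum_distrib_right algebra_simps)
  qed
qed

lemma zeta_eq_continuation:
  assumes s: "\<alpha> < Re s" "Re s < real (Suc genus)"
  shows "zeta s = continuation s"
proof -
  let ?f = "\<lambda>x. exp (- s * of_real x) * log_deriv x"
  have int: "set_integrable lborel A ?f" if "A \<in> sets lborel" for A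
    using mellin_integrable[OF s] that unfolding set_integrable_def by (intro integrable_mult_indicator)
  have "{..<0} \<union> {0::real..} = UNIV"
    by auto
  then have "(LINT x|lborel. ?f x) = (LINT x:{..<0} \<union> {0..}|lborel. ?f x)"
    by (simp add: set_lebesgue_integral_def)
  also have "\<dots> = (LINT x:{..<0}|lborel. ?f x) + (LINT x:{0..}|lborel. ?f x)"
    by (intro set_integral_Un int) auto
  also have "(LINT x:{..<0}|lborel. ?f x) = (LINT x:{0<..}|lborel. ?f (- x))"
    by (subst set_integral_reflect) (simp add: greaterThan_def)
  also have "\<dots> = (LINT x:{0..}|lborel. ?f (- x))"
    by (rule set_integral_discrete_difference[of "{0}"]) auto
  also have "\<dots> = near_part s + lam 0"
    by (simp add: near_part_def laplace_def)
  also have "(LINT x:{0..}|lborel. ?f x) = s * (principal_sum s + laplace R s) - lam 0"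
  proof -
    obtain \<eta> where \<eta>: "\<alpha> < \<eta>" "\<eta> < Re s"
      using dense[OF s(1)] by blast
    obtain D where D: "\<And>x. x \<ge> 0 \<Longrightarrow> norm (lam x) \<le> D * exp (\<eta> * x)"
      using lam_bound[OF \<eta>(1)] by blast
    have "laplace log_deriv s = s * laplace lam s - lam 0"
    proof (rule laplace_derivative[OF _ _ D \<eta>(2)])
      show "(lam has_vector_derivative log_deriv x) (at x within {0..})" for x
        using lam_deriv by (rule has_vector_derivative_at_within)
      show "continuous_on {0..} log_deriv"
        using log_deriv_cont by (rule continuous_on_subset) auto
      show "set_integrable lborel {0..} ?f"
        by (rule int) auto
    qed
    then show ?thesis
      using laplace_lam[OF s(1)] by (simp add: laplace_def)
  qed
  finally show ?thesis
    using zeta_mellin[OF s] by (simp add: continuation_def)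
qed

text \<open>
  The strip where the expansion continues the zeta function is bounded on the right by \<open>\<lfloor>\<alpha>\<rfloor> + 1\<close>;
  further to the right the series takes over.
\<close>

definition glued :: "complex \<Rightarrow> complex" where
  "glued s = (if Re s > \<alpha> then zeta s else continuation s)"

lemma glued_eq_continuation: "Re s < real (Suc genus) \<Longrightarrow> glued s = continuation s"
  by (simp add: glued_def zeta_eq_continuation)

lemma glued_meromorphic: "glued meromorphic_on {s. Re s > \<sigma>}"
proof -
  have "glued meromorphic_on strip"
  proof -
    have "eventually (\<lambda>w. glued w = continuation w) (at s)" if "s \<in> strip" for s
      using eventually_at_in_open'[OF open_strip that]
      by eventually_elim (simp add: glued_eq_continuation strip_def)
    then show ?thesis
      using continuation_meromorphic meromorphic_on_cong[of strip glued continuation strip] by blast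
  qed
  moreover have "glued meromorphic_on {s. Re s > \<alpha>}"
  proof (intro analytic_on_imp_meromorphic_on)
    have "glued holomorphic_on {s. Re s > \<alpha>} \<longleftrightarrow> zeta holomorphic_on {s. Re s > \<alpha>}"
      by (intro holomorphic_cong) (auto simp: glued_def)
    then show "glued analytic_on {s. Re s > \<alpha>}"
      using zeta_holomorphic by (simp add: analytic_on_open open_halfspace_Re_gt)
  qed
  ultimately have "glued meromorphic_on (strip \<union> {s. Re s > \<alpha>})"
    by (rule meromorphic_on_Un)
  then show ?thesis
    by (rule meromorphic_on_subset) (use genus in \<open>auto simp: strip_def\<close>)
qed

lemma continuation_exists:
  "remove_sings glued nicely_meromorphic_on {s. Re s > \<sigma>}"
  "Re s > \<alpha> \<Longrightarrow> remove_sings glued s = zeta s"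
proof -
  show "remove_sings glued nicely_meromorphic_on {s. Re s > \<sigma>}"
    using glued_meromorphic by (rule remove_sings_nicely_meromorphic)
  assume s: "Re s > \<alpha>"
  have "zeta analytic_on {s}"
    using s zeta_holomorphic by (auto simp: analytic_at open_halfspace_Re_gt intro!: exI[of _ "{s. Re s > \<alpha>}"])
  then have "zeta \<midarrow>s\<rightarrow> zeta s"
    using analytic_at_imp_isCont isCont_def by blast
  moreover have "eventually (\<lambda>w. zeta w = glued w) (at s)"
    using eventually_at_in_open'[of "{s. Re s > \<alpha>}" s] s
    by (auto simp: open_halfspace_Re_gt glued_def elim!: eventually_mono)
  ultimately have "glued \<midarrow>s\<rightarrow> zeta s"
    by (rule Lim_transform_eventually)
  then show "remove_sings glued s = zeta s"
    by (rule remove_sings_eqI)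
qed

context
  fixes Z :: "complex \<Rightarrow> complex"
  assumes Z_mero: "Z nicely_meromorphic_on {s. Re s > \<sigma>}"
    and Z_eq: "\<And>s. Re s > \<alpha> \<Longrightarrow> Z s = zeta s"
begin

lemma Z_eq_continuation:
  assumes s: "s \<in> strip"
  shows "eventually (\<lambda>w. Z w = continuation w) (at s)"
proof -
  have "eventually (\<lambda>w. Z w = glued w) (at s)"
  proof (rule meromorphic_identity[where A = "{s. Re s > \<sigma>}" and B = "{s. Re s > \<alpha>}"])
    show "connected {s. Re s > \<sigma>}"
      by (intro convex_connected convex_halfspace_Re_gt)
    have "of_real (\<alpha> + 1) \<in> {s. Re s > \<alpha>}"
      by simp
    then show "{s. Re s > \<alpha>} \<noteq> {}"
      by blast
    show "Z z = glued z" if "z \<in> {s. Re s > \<alpha>}" for z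
      using that Z_eq by (simp add: glued_def)
  qed (use Z_mero glued_meromorphic sigma s in
    \<open>auto simp: nicely_meromorphic_on_def open_halfspace_Re_gt strip_def\<close>)
  with eventually_at_in_open'[OF open_strip s] show ?thesis
    by eventually_elim (simp add: glued_eq_continuation strip_def)
qed

text \<open>
  If \<open>s * reflection_factor s\<close> has a zero of order \<open>r\<close> at \<open>\<beta>0\<close>, it lowers the order \<open>K + 1\<close> of the pole of
  the expansion to \<open>K + 1 - r\<close>. The numerator at \<open>\<beta>0\<close> is given in a form that serves both uses: for
  \<open>r < K + 1\<close> its first summand vanishes and the second one shows that the pole is genuine; for
  \<open>r = K + 1\<close> it is the value of \<open>Z\<close>.
\<close>

lemma local_form:
  assumes \<beta>0: "\<beta>0 \<in> strip"
    and K: "\<And>i. i \<in> I \<Longrightarrow> \<beta> i = \<beta>0 \<Longrightarrow> c i \<noteq> 0 \<Longrightarrow> k i \<le> K"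
    and U: "U holomorphic_on UNIV" "\<And>s. s * reflection_factor s = (s - \<beta>0) ^ r * U s"
    and r: "r \<le> Suc K"
  obtains H h where "H analytic_on {\<beta>0}"
    "eventually (\<lambda>s. Z s = H s / (s - \<beta>0) ^ (Suc K - r)) (at \<beta>0)"
    "H \<beta>0 = 0 ^ (Suc K - r) * reflection_factor \<beta>0 * h +
       U \<beta>0 * (fact K * (\<Sum>i | i \<in> I \<and> \<beta> i = \<beta>0 \<and> k i = K. c i))"
proof -
  have "\<exists>h Q. h analytic_on {\<beta>0} \<and> Q analytic_on {\<beta>0} \<and>
      Q \<beta>0 = fact K * (\<Sum>i | i \<in> I \<and> \<beta> i = \<beta>0 \<and> k i = K. c i) \<and>
      (\<forall>s. s \<noteq> \<beta>0 \<longrightarrow> principal_sum s = h s + Q s / (s - \<beta>0) ^ Suc K)"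
    unfolding principal_sum_def by (rule principal_part_split[OF finite_I]) (rule K)
  then obtain h Q where h: "h analytic_on {\<beta>0}" and Q: "Q analytic_on {\<beta>0}"
    and Q0: "Q \<beta>0 = fact K * (\<Sum>i | i \<in> I \<and> \<beta> i = \<beta>0 \<and> k i = K. c i)"
    and "\<forall>s. s \<noteq> \<beta>0 \<longrightarrow> principal_sum s = h s + Q s / (s - \<beta>0) ^ Suc K"
    by (elim exE conjE) (rule that)
  then have split: "\<And>s. s \<noteq> \<beta>0 \<Longrightarrow> principal_sum s = h s + Q s / (s - \<beta>0) ^ Suc K"
    by blast
  define g where "g = (\<lambda>s. near_part s + s * (h s + laplace R s))"
  define H where "H = (\<lambda>s. (s - \<beta>0) ^ (Suc K - r) * reflection_factor s * g s + U s * Q s)"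
  have "near_part analytic_on {\<beta>0}"
    using near_part_holomorphic \<beta>0 open_halfspace_Re_lt[of "real (Suc genus)"]
    unfolding analytic_at strip_def by blast
  moreover have "laplace R analytic_on {\<beta>0}"
    using laplace_R_holomorphic \<beta>0 open_halfspace_Re_gt[of \<sigma>]
    unfolding analytic_at strip_def by blast
  moreover have "reflection_factor analytic_on {\<beta>0}" "U analytic_on {\<beta>0}"
    using reflection_factor_holomorphic U unfolding analytic_at by blast+
  ultimately have "H analytic_on {\<beta>0}"
    unfolding H_def g_def using h Q by (intro analytic_intros)
  moreover have "eventually (\<lambda>s. s \<noteq> \<beta>0) (at \<beta>0)"
    by (simp add: eventually_at_filter)
  then have "eventually (\<lambda>s. Z s = H s / (s - \<beta>0) ^ (Suc K - r)) (at \<beta>0)"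
    using Z_eq_continuation[OF \<beta>0]
  proof eventually_elim
    case (elim s)
    have pow: "(s - \<beta>0) ^ Suc K = (s - \<beta>0) ^ r * (s - \<beta>0) ^ (Suc K - r)"
      using r by (simp add: power_add[symmetric] del: power_Suc)
    have "Z s = reflection_factor s * g s + (s * reflection_factor s) * (Q s / (s - \<beta>0) ^ Suc K)"
      unfolding elim(2) continuation_def split[OF elim(1)] g_def by (simp add: algebra_simps del: power_Suc)
    also have "(s * reflection_factor s) * (Q s / (s - \<beta>0) ^ Suc K) = U s * Q s / (s - \<beta>0) ^ (Suc K - r)"
      unfolding U(2) pow using elim(1) by simp
    also have "reflection_factor s * g s + \<dots> = H s / (s - \<beta>0) ^ (Suc K - r)"
      using elim(1) by (simp add: H_def add_divide_distrib)
    finally show ?case .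
  qed
  moreover have "H \<beta>0 = 0 ^ (Suc K - r) * reflection_factor \<beta>0 * g \<beta>0 +
       U \<beta>0 * (fact K * (\<Sum>i | i \<in> I \<and> \<beta> i = \<beta>0 \<and> k i = K. c i))"
    by (simp add: H_def Q0)
  ultimately show thesis
    by (rule that)
qed

lemma pole_of_order_continuation:
  assumes \<beta>0: "\<beta>0 \<in> strip"
    and K: "\<And>i. i \<in> I \<Longrightarrow> \<beta> i = \<beta>0 \<Longrightarrow> c i \<noteq> 0 \<Longrightarrow> k i \<le> K"
    and U: "U holomorphic_on UNIV" "\<And>s. s * reflection_factor s = (s - \<beta>0) ^ r * U s" "U \<beta>0 \<noteq> 0"
    and r: "r \<le> Suc K"
    and nz: "r < Suc K \<Longrightarrow> (\<Sum>i | i \<in> I \<and> \<beta> i = \<beta>0 \<and> k i = K. c i) \<noteq> 0"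
  shows "pole_of_order Z \<beta>0 (Suc K - r)"
proof -
  obtain H h where H: "H analytic_on {\<beta>0}"
    "eventually (\<lambda>s. Z s = H s / (s - \<beta>0) ^ (Suc K - r)) (at \<beta>0)"
    "H \<beta>0 = 0 ^ (Suc K - r) * reflection_factor \<beta>0 * h +
       U \<beta>0 * (fact K * (\<Sum>i | i \<in> I \<and> \<beta> i = \<beta>0 \<and> k i = K. c i))"
    using local_form[OF \<beta>0 K U(1,2) r] by blast
  show ?thesis
  proof (rule pole_of_orderI[OF Z_mero _ H(1,2)])
    show "\<beta>0 \<in> {s. Re s > \<sigma>}"
      using \<beta>0 by (simp add: strip_def)
    show "H \<beta>0 \<noteq> 0" if "Suc K - r > 0"
      using that U(3) nz by (simp add: H(3) power_0_left del: power_Suc)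
  qed
qed

lemma nonint_pole:
  assumes "x \<notin> \<int>" "\<sigma> < x" "x \<le> \<alpha>"
    and K: "\<And>i. i \<in> I \<Longrightarrow> \<beta> i = of_real x \<Longrightarrow> c i \<noteq> 0 \<Longrightarrow> k i \<le> K"
    and nz: "(\<Sum>i | i \<in> I \<and> \<beta> i = of_real x \<and> k i = K. c i) \<noteq> 0"
  shows "pole_of_order Z (of_real x) (Suc K)"
proof -
  have "x \<noteq> 0"
    using assms(1) by auto
  have "pole_of_order Z (of_real x) (Suc K - 0)"
  proof (rule pole_of_order_continuation[OF _ K])
    show "(\<lambda>s. s * reflection_factor s) holomorphic_on UNIV"
      by (intro holomorphic_intros reflection_factor_holomorphic)
  qed (use assms genus \<open>x \<noteq> 0\<close> reflection_factor_nonzero in \<open>auto simp: strip_def\<close>)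
  then show ?thesis
    by simp
qed

text \<open>
  For \<open>K = 0\<close> a simple pole of the expansion is cancelled, whatever its residue; in particular the
  monomials of \<open>\<omega>\<close>, which have \<open>k i = 0\<close>, leave no trace.
\<close>

lemma int_pole:
  fixes n :: int
  assumes "n \<noteq> 0" "\<sigma> < of_int n" "of_int n \<le> \<alpha>"
    and K: "\<And>i. i \<in> I \<Longrightarrow> \<beta> i = of_int n \<Longrightarrow> c i \<noteq> 0 \<Longrightarrow> k i \<le> K"
    and nz: "K > 0 \<Longrightarrow> (\<Sum>i | i \<in> I \<and> \<beta> i = of_int n \<and> k i = K. c i) \<noteq> 0"
  shows "pole_of_order Z (of_int n) K"
proof -
  obtain U where U: "U holomorphic_on UNIV" "U (of_int n) = exp (- \<i> * of_int n * \<Psi>)"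
    "\<And>s. reflection_factor s = (s - of_int n) * U s"
    using reflection_factor_integer[of n] by blast
  have "pole_of_order Z (of_int n) (Suc K - 1)"
  proof (rule pole_of_order_continuation[OF _ K])
    show "(\<lambda>s. s * U s) holomorphic_on UNIV"
      by (intro holomorphic_intros U)
  qed (use assms genus U in \<open>auto simp: strip_def\<close>)
  then show ?thesis
    by simp
qed

lemma reflection_factor_zero_at_0:
  obtains U where "U holomorphic_on UNIV" "U 0 = 1" "\<And>s. s * reflection_factor s = (s - 0) ^ 2 * U s"
proof -
  obtain U where U: "U holomorphic_on UNIV" "U (of_int 0) = exp (- \<i> * of_int 0 * \<Psi>)"
    "\<And>s. reflection_factor s = (s - of_int 0) * U s"
    using reflection_factor_integer[of 0] by blast
  then show thesis
    using that[of U] by (simp add: power2_eq_square)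
qed

lemma zero_pole:
  assumes "\<sigma> < 0" "K \<ge> 2"
    and K: "\<And>i. i \<in> I \<Longrightarrow> \<beta> i = 0 \<Longrightarrow> c i \<noteq> 0 \<Longrightarrow> k i \<le> K"
    and nz: "(\<Sum>i | i \<in> I \<and> \<beta> i = 0 \<and> k i = K. c i) \<noteq> 0"
  shows "pole_of_order Z 0 (K - 1)"
proof -
  obtain U where U: "U holomorphic_on UNIV" "U 0 = 1" "\<And>s. s * reflection_factor s = (s - 0) ^ 2 * U s"
    using reflection_factor_zero_at_0 by blast
  have "pole_of_order Z 0 (Suc K - 2)"
    by (rule pole_of_order_continuation[OF _ K U(1,3)])
      (use assms alpha genus U in \<open>auto simp: strip_def\<close>)
  then show ?thesis
    using assms(2) by (simp add: numeral_2_eq_2)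
qed

text \<open>
  The double zero of \<open>s * reflection_factor s\<close> at 0, where its second-order coefficient is 1, cancels
  a double pole and leaves its coefficient.
\<close>

lemma zero_regular:
  assumes "\<sigma> < 0"
    and K: "\<And>i. i \<in> I \<Longrightarrow> \<beta> i = 0 \<Longrightarrow> c i \<noteq> 0 \<Longrightarrow> k i \<le> 1"
  shows "Z analytic_on {0}" "Z 0 = (\<Sum>i | i \<in> I \<and> \<beta> i = 0 \<and> k i = 1. c i)"
proof -
  obtain U where U: "U holomorphic_on UNIV" "U 0 = 1" "\<And>s. s * reflection_factor s = (s - 0) ^ 2 * U s"
    using reflection_factor_zero_at_0 by blast
  have strip: "0 \<in> strip"
    using assms alpha genus by (simp add: strip_def)
  obtain H h where H: "H analytic_on {0}"
    "eventually (\<lambda>s. Z s = H s / (s - 0) ^ (Suc 1 - 2)) (at 0)"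
    "H 0 = 0 ^ (Suc 1 - 2) * reflection_factor 0 * h +
       U 0 * (fact 1 * (\<Sum>i | i \<in> I \<and> \<beta> i = 0 \<and> k i = 1. c i))"
    using local_form[OF strip K U(1,3)] by auto
  have "0 \<in> {s. Re s > \<sigma>}"
    using assms by simp
  note Z = nicely_meromorphic_removable[OF Z_mero this H(1)]
  show "Z analytic_on {0}"
    using H(2) by (intro Z) simp
  have "Z 0 = H 0"
    using H(2) by (intro Z) simp
  also have "\<dots> = (\<Sum>i | i \<in> I \<and> \<beta> i = 0 \<and> k i = 1. c i)"
    using H(3) U by (simp add: reflection_factor_def)
  finally show "Z 0 = (\<Sum>i | i \<in> I \<and> \<beta> i = 0 \<and> k i = 1. c i)" .
qed

end

end

section \<open>Branches of the logarithm and the exponent of convergence\<close>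

lemma branch_ln_exp:
  assumes "l < Im w" "Im w < u" "u - l \<le> 2 * pi"
  shows "branch_ln l u (exp w) = w"
proof -
  have "(THE \<theta>. l < \<theta> \<and> \<theta> < u \<and> is_Arg (exp w) \<theta>) = Im w"
  proof (rule the_equality)
    show "\<theta> = Im w" if "l < \<theta> \<and> \<theta> < u \<and> is_Arg (exp w) \<theta>" for \<theta>
      using that assms is_Arg_exp_Im[of w] by (intro is_Arg_eqI[of "exp w"]) auto
  qed (use assms is_Arg_exp_Im in auto)
  then show ?thesis
    by (simp add: branch_ln_def complex_eq_iff)
qed

lemma branch_power_exp:
  assumes "l < Im w" "Im w < u" "u - l \<le> 2 * pi"
  shows "branch_power l u (exp w) \<beta> = exp (\<beta> * w)"
  by (simp add: branch_power_def branch_ln_exp[OF assms])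

lemma sector_eq_exp_image: "sector \<Psi> \<epsilon> = exp ` {w. \<Psi> - \<epsilon> < Im w \<and> Im w < \<Psi> + \<epsilon>}"
proof (intro equalityI subsetI)
  fix z assume "z \<in> sector \<Psi> \<epsilon>"
  then obtain \<theta> where z: "z \<noteq> 0" and \<theta>: "\<Psi> - \<epsilon> < \<theta>" "\<theta> < \<Psi> + \<epsilon>" "is_Arg z \<theta>"
    by (auto simp: sector_def)
  have "exp (Complex (ln (cmod z)) \<theta>) = z"
    using \<theta>(3) z by (simp add: is_Arg_def Complex_eq exp_add exp_of_real)
  with \<theta> show "z \<in> exp ` {w. \<Psi> - \<epsilon> < Im w \<and> Im w < \<Psi> + \<epsilon>}"
    by (intro image_eqI[of _ _ "Complex (ln (cmod z)) \<theta>"]) auto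
qed (use is_Arg_exp_Im in \<open>auto simp: sector_def\<close>)

lemma open_sector: "open (sector \<Psi> \<epsilon>)"
  unfolding sector_eq_exp_image
proof (rule open_mapping_thm[of exp UNIV])
  have "{w. \<Psi> - \<epsilon> < Im w \<and> Im w < \<Psi> + \<epsilon>} = {w. Im w > \<Psi> - \<epsilon>} \<inter> {w. Im w < \<Psi> + \<epsilon>}"
    by auto
  then show "open {w. \<Psi> - \<epsilon> < Im w \<and> Im w < \<Psi> + \<epsilon>}"
    by (simp add: open_Int open_halfspace_Im_gt open_halfspace_Im_lt)
  show "\<not> (exp :: complex \<Rightarrow> complex) constant_on UNIV"
  proof
    assume "(exp :: complex \<Rightarrow> complex) constant_on UNIV"
    then have "exp (0 :: complex) = exp (of_real (ln 2))"
      by (metis UNIV_I constant_on_def)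
    then show False
      by (simp add: exp_of_real)
  qed
qed (auto intro: holomorphic_on_exp)

lemma log_outside_sector:
  assumes "\<epsilon> > 0" "z \<noteq> 0" "z \<notin> sector \<Psi> \<epsilon>"
  obtains w where "exp w = z" "\<Psi> - 2 * pi + \<epsilon> \<le> Im w" "Im w \<le> \<Psi> - \<epsilon>"
proof -
  (* The argument of z relative to the ray, in [0, 2 * pi); z lies in the sector exactly if t is
     within \<epsilon> of one of the two ends. *)
  define t where "t = Arg2pi (z * exp (- \<i> * \<Psi>))"
  have t: "0 \<le> t" "t < 2 * pi" and "is_Arg (z * exp (- \<i> * \<Psi>)) t"
    using Arg2pi by (auto simp: t_def)
  then have "z * exp (- \<i> * \<Psi>) = cmod z * exp (\<i> * t)"
    by (simp add: is_Arg_def norm_mult)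
  then have "(z * exp (- \<i> * \<Psi>)) * exp (\<i> * \<Psi>) = cmod z * (exp (\<i> * t) * exp (\<i> * \<Psi>))"
    by simp
  then have z: "z = cmod z * exp (\<i> * of_real (t + \<Psi>))"
    by (simp add: mult.assoc exp_add[symmetric] algebra_simps)
  then have arg: "is_Arg z (t + \<Psi>)"
    by (simp add: is_Arg_def)
  then have "is_Arg z (t + \<Psi> + of_int (- 1) * (2 * pi))"
    by (simp only: is_Arg_2pi_iff)
  then have arg': "is_Arg z (t + \<Psi> - 2 * pi)"
    by simp
  have "t \<ge> \<epsilon>"
    using assms arg t by (force simp: sector_def)
  moreover have "t \<le> 2 * pi - \<epsilon>"
    using assms arg' t by (force simp: sector_def)
  moreover have "exp (Complex (ln (cmod z)) (t + \<Psi> - 2 * pi)) = z"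
    using arg' assms(2) by (simp add: is_Arg_def Complex_eq exp_add exp_of_real)
  ultimately show thesis
    using that[of "Complex (ln (cmod z)) (t + \<Psi> - 2 * pi)"] by simp
qed

lemma exponent_of_convergence_nonneg:
  assumes lim: "filterlim (\<lambda>n. cmod (a n)) at_top sequentially"
    and exponent: "exponent_of_convergence a = ereal \<alpha>"
  shows "\<alpha> \<ge> 0"
proof (rule ccontr)
  assume "\<not> \<alpha> \<ge> 0"
  then have "eventually (\<lambda>n. ereal (ln (real (Suc n)) / ln (cmod (a n))) < 0) sequentially"
    using exponent unfolding exponent_of_convergence_def by (intro Limsup_lessD) auto
  moreover have "eventually (\<lambda>n. cmod (a n) > 1) sequentially"
    using lim by (simp add: filterlim_at_top_dense)
  ultimately have "eventually (\<lambda>n. False) sequentially"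
  proof eventually_elim
    case (elim n)
    have "ln (real (Suc n)) / ln (cmod (a n)) \<ge> 0"
      using ln_gt_zero[OF elim(2)] by (intro divide_nonneg_pos ln_ge_zero) auto
    with elim(1) show ?case
      by simp
  qed
  then show False
    by simp
qed

text \<open>
  For \<open>\<alpha> < \<eta> < \<sigma>\<close> one has \<open>n + 1 \<le> |a_n|^\<eta>\<close> eventually, hence \<open>|a_n|^(-\<sigma>) \<le> (n + 1)^(-\<sigma>/\<eta>)\<close>, and
  \<open>\<sigma>/\<eta> > 1\<close>.
\<close>

lemma exponent_of_convergence_summable:
  assumes lim: "filterlim (\<lambda>n. cmod (a n)) at_top sequentially"
    and exponent: "exponent_of_convergence a = ereal \<alpha>" and \<sigma>: "\<sigma> > \<alpha>"
  shows "summable (\<lambda>n. exp (- \<sigma> * ln (cmod (a n))))"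
proof -
  have "\<alpha> \<ge> 0"
    using exponent_of_convergence_nonneg[OF lim exponent] .
  obtain \<eta> where \<eta>: "\<alpha> < \<eta>" "\<eta> < \<sigma>"
    using dense[OF \<sigma>] by blast
  have "eventually (\<lambda>n. ereal (ln (real (Suc n)) / ln (cmod (a n))) < ereal \<eta>) sequentially"
    using exponent \<eta> unfolding exponent_of_convergence_def by (intro Limsup_lessD) auto
  moreover have "eventually (\<lambda>n. cmod (a n) > 1) sequentially"
    using lim by (simp add: filterlim_at_top_dense)
  ultimately have ev: "eventually (\<lambda>n. norm (exp (- \<sigma> * ln (cmod (a n)))) \<le> real (Suc n) powr (- (\<sigma> / \<eta>))) sequentially"
  proof eventually_elim
    case (elim n)
    have "ln (real (Suc n)) \<le> \<eta> * ln (cmod (a n))"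
      using elim(1) ln_gt_zero[OF elim(2)] by (simp add: pos_divide_less_eq)
    then have "\<sigma> / \<eta> * ln (real (Suc n)) \<le> \<sigma> / \<eta> * (\<eta> * ln (cmod (a n)))"
      using \<eta> \<open>\<alpha> \<ge> 0\<close> by (intro mult_left_mono) auto
    then have "- \<sigma> * ln (cmod (a n)) \<le> - (\<sigma> / \<eta>) * ln (real (Suc n))"
      using \<eta> \<open>\<alpha> \<ge> 0\<close> by simp
    then show ?case
      by (simp add: powr_def)
  qed
  have "summable (\<lambda>n. real n powr (- (\<sigma> / \<eta>)))"
    using \<eta> \<open>\<alpha> \<ge> 0\<close> by (simp add: summable_real_powr_iff field_simps)
  then have "summable (\<lambda>n. real (Suc n) powr (- (\<sigma> / \<eta>)))"
    by (subst summable_Suc_iff)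
  then show ?thesis
    using ev by (rule summable_comparison_test_ev[rotated])
qed

lemma exp_ray_in_sector: "\<epsilon> > 0 \<Longrightarrow> exp (Complex x \<Psi>) \<in> sector \<Psi> \<epsilon>"
  by (simp add: sector_eq_exp_image)

lemma smallo_on_ray:
  assumes f: "f \<in> o[inf at_infinity (principal (sector \<Psi> \<epsilon>))](\<lambda>z. branch_power (\<Psi> - \<epsilon>) (\<Psi> + \<epsilon>) z (of_real \<sigma>))"
    and \<epsilon>: "0 < \<epsilon>" "\<epsilon> \<le> pi"
  shows "eventually (\<lambda>x. norm (f (exp (Complex x \<Psi>))) \<le> exp (\<sigma> * x)) at_top"
proof -
  have "filterlim (\<lambda>x. exp (Complex x \<Psi>)) (inf at_infinity (principal (sector \<Psi> \<epsilon>))) at_top"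
    unfolding filterlim_inf filterlim_principal
  proof
    show "filterlim (\<lambda>x. exp (Complex x \<Psi>)) at_infinity at_top"
      by (rule filterlim_norm_at_top_imp_at_infinity) (simp add: exp_at_top)
  qed (use \<epsilon> exp_ray_in_sector in auto)
  moreover have "eventually (\<lambda>z. norm (f z) \<le> 1 * norm (branch_power (\<Psi> - \<epsilon>) (\<Psi> + \<epsilon>) z (of_real \<sigma>)))
      (inf at_infinity (principal (sector \<Psi> \<epsilon>)))"
    using f by (rule landau_o.smallD) simp
  ultimately have "eventually (\<lambda>x. norm (f (exp (Complex x \<Psi>))) \<le>
      1 * norm (branch_power (\<Psi> - \<epsilon>) (\<Psi> + \<epsilon>) (exp (Complex x \<Psi>)) (of_real \<sigma>))) at_top"
    by (rule eventually_compose_filterlim[rotated])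
  then show ?thesis
    using \<epsilon> by (simp add: branch_power_exp)
qed


section \<open>The logarithmic derivative of the canonical product\<close>

text \<open>
  The derivative of the exponent is the geometric sum \<open>(1 - u^p) / (1 - u)\<close>, so that only \<open>u^p\<close> is left of
  the logarithmic derivative.
\<close>

lemma weierstrass_factor_has_derivative:
  assumes "u \<noteq> 1"
  shows "(weierstrass_factor p has_field_derivative - (u ^ p / (1 - u)) * weierstrass_factor p u) (at u)"
proof -
  define S where "S = (\<lambda>u::complex. \<Sum>k=1..p. u ^ k / of_nat k)"
  have "(S has_field_derivative (\<Sum>k=1..p. u ^ (k - 1))) (at u)"
    unfolding S_def by (rule derivative_eq_intros refl | simp)+
  moreover have "(\<Sum>k=1..p. u ^ (k - 1)) = (\<Sum>k<p. u ^ k)"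
    by (rule sum.reindex_bij_witness[of _ Suc "\<lambda>k. k - 1"]) auto
  ultimately have S: "(S has_field_derivative (1 - u ^ p) / (1 - u)) (at u)"
    using assms by (simp add: sum_gp_strict)
  have "((\<lambda>u. (1 - u) * exp (S u)) has_field_derivative
      - exp (S u) + (1 - u) * (exp (S u) * ((1 - u ^ p) / (1 - u)))) (at u)"
    by (rule derivative_eq_intros S refl)+ simp
  also have "- exp (S u) + (1 - u) * (exp (S u) * ((1 - u ^ p) / (1 - u))) =
      - (u ^ p / (1 - u)) * ((1 - u) * exp (S u))"
    using assms by (simp add: field_simps)
  finally show ?thesis
    by (simp add: weierstrass_factor_def[abs_def] S_def)
qed

context log_zeros
begin

lemma weierstrass_product_zeros:
  assumes a: "\<And>n. a n = exp (b n)" and lim: "filterlim (\<lambda>n. cmod (a n)) at_top sequentially"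
  shows "weierstrass_product a (\<lambda>_. genus)"
proof
  show "a n \<noteq> 0" for n
    by (simp add: a)
  show "filterlim a at_infinity sequentially"
    using lim by (rule filterlim_norm_at_top_imp_at_infinity)
  fix r :: real assume r: "r > 0"
  have eq: "(r / norm (a n)) ^ Suc genus = r ^ Suc genus * exp (- real (Suc genus) * Re (b n))" for n
  proof -
    have "exp (- real (Suc genus) * Re (b n)) = inverse (exp (Re (b n)) ^ Suc genus)"
      by (simp only: mult_minus_left exp_minus exp_of_nat_mult)
    then show ?thesis
      by (simp only: a norm_exp_eq_Re power_mult_distrib power_inverse divide_inverse)
  qed
  then show "summable (\<lambda>n. (r / norm (a n)) ^ Suc genus)"
    unfolding eq by (intro summable_mult summable_b genus(2))
qed

lemma log_deriv_canonical_product: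
  fixes x :: real
  defines "z \<equiv> exp (Complex x \<Psi>)"
  assumes a: "\<And>n. a n = exp (b n)" and lim: "filterlim (\<lambda>n. cmod (a n)) at_top sequentially"
    and nz: "canonical_product a \<alpha> z \<noteq> 0"
  shows "log_deriv x = z * (deriv (canonical_product a \<alpha>) z / canonical_product a \<alpha> z)"
proof -
  interpret W: weierstrass_product a "\<lambda>_. genus"
    by (rule weierstrass_product_zeros[OF a lim])
  have f: "W.f = canonical_product a \<alpha>"
    by (simp add: fun_eq_iff W.f_def canonical_product_def)
  define R where "R = cmod z + 1"
  have R: "R > 0" "z \<in> ball 0 R"
    by (auto simp: R_def add_nonneg_pos)
  have "uniform_limit (ball 0 R) (\<lambda>N z. \<Prod>n<N. weierstrass_factor genus (z / a n)) (canonical_product a \<alpha>) sequentially"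
    using uniform_limit_on_subset[OF W.uniform_limit[OF R(1)] ball_subset_cball] by (simp add: f)
  then have "(\<lambda>n. deriv (\<lambda>z. weierstrass_factor genus (z / a n)) z / weierstrass_factor genus (z / a n)) sums
      (deriv (canonical_product a \<alpha>) z / canonical_product a \<alpha> z)"
    by (rule logderiv_prodinf_complex_uniform_limit)
      (use nz R W.a_nonzero in \<open>auto intro!: holomorphic_intros\<close>)
  then have "(\<lambda>n. z * (deriv (\<lambda>z. weierstrass_factor genus (z / a n)) z / weierstrass_factor genus (z / a n))) sums
      (z * (deriv (canonical_product a \<alpha>) z / canonical_product a \<alpha> z))"
    by (rule sums_mult)
  moreover have "z * (deriv (\<lambda>z. weierstrass_factor genus (z / a n)) z / weierstrass_factor genus (z / a n)) =
      log_deriv_term n x" for n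
  proof -
    have q: "z / a n = ratio n x"
      by (simp add: z_def a ratio_def exp_diff)
    have "z \<notin> range a"
      using nz W.zero[of z] f by simp
    then have q1: "z / a n \<noteq> 1"
      using W.a_nonzero[of n] by auto
    have "((\<lambda>z. weierstrass_factor genus (z / a n)) has_field_derivative
        - ((z / a n) ^ genus / (1 - z / a n)) * weierstrass_factor genus (z / a n) * (1 / a n)) (at z)"
      by (rule DERIV_chain2[where g = "\<lambda>z. z / a n", OF weierstrass_factor_has_derivative[OF q1]])
        (use W.a_nonzero in \<open>auto intro!: derivative_eq_intros\<close>)
    then have "deriv (\<lambda>z. weierstrass_factor genus (z / a n)) z =
        - ((z / a n) ^ genus / (1 - z / a n)) * weierstrass_factor genus (z / a n) * (1 / a n)"
      by (rule DERIV_imp_deriv)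
    moreover have "weierstrass_factor genus (z / a n) \<noteq> 0"
      using q1 by simp
    ultimately have "z * (deriv (\<lambda>z. weierstrass_factor genus (z / a n)) z / weierstrass_factor genus (z / a n)) =
        - ((z / a n) * (z / a n) ^ genus / (1 - z / a n))"
      by simp
    then show ?thesis
      by (simp add: log_deriv_term_def q)
  qed
  ultimately show ?thesis
    unfolding log_deriv_def by (simp add: sums_iff)
qed

end

text \<open>
  Differentiating \<open>exp (L z) = exp (\<omega> z) * f z\<close>, with \<open>f\<close> the canonical product, gives
  \<open>L' - \<omega>' = f'/f\<close>. Continuity of \<open>log_deriv\<close> is obtained from
  this closed form rather than from its series.
\<close>

lemma (in log_zeros) log_characteristic_function_derivative:
  assumes a: "\<And>n. a n = exp (b n)" and lim: "filterlim (\<lambda>n. cmod (a n)) at_top sequentially"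
    and F: "\<And>z. F z = exp (poly \<omega> z) * canonical_product a \<alpha> z"
    and L: "L holomorphic_on sector \<Psi> \<epsilon>" "\<And>z. z \<in> sector \<Psi> \<epsilon> \<Longrightarrow> exp (L z) = F z"
  shows "((\<lambda>x. L (exp (Complex x \<Psi>)) - poly \<omega> (exp (Complex x \<Psi>))) has_vector_derivative log_deriv x) (at x)"
    and "continuous_on UNIV log_deriv"
proof -
  interpret W: weierstrass_product a "\<lambda>_. genus"
    by (rule weierstrass_product_zeros[OF a lim])
  define f where "f = canonical_product a \<alpha>"
  have "W.f = f"
    by (simp add: fun_eq_iff W.f_def canonical_product_def f_def)
  then have f_holo: "f holomorphic_on UNIV"
    using W.holomorphic[of UNIV] by simp
  have f_nz: "f z \<noteq> 0" if "z \<in> sector \<Psi> \<epsilon>" for z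
    using L(2)[OF that] F[of z] by (auto simp: f_def)
  have ray: "exp (Complex x \<Psi>) \<in> sector \<Psi> \<epsilon>" for x
    using eps by (rule exp_ray_in_sector)
  have ld: "log_deriv x = exp (Complex x \<Psi>) * (deriv f (exp (Complex x \<Psi>)) / f (exp (Complex x \<Psi>)))" for x
    using log_deriv_canonical_product[OF a lim] f_nz[OF ray] by (simp add: f_def)
  have cont_ray: "continuous_on UNIV (\<lambda>x. exp (Complex x \<Psi>))"
    by (auto simp: Complex_eq intro!: continuous_intros)
  have "deriv f holomorphic_on UNIV"
    using f_holo by (intro holomorphic_deriv) auto
  then have "continuous_on UNIV (deriv f)" "continuous_on UNIV f"
    using f_holo by (auto intro: holomorphic_on_imp_continuous_on)
  then have "continuous_on UNIV (\<lambda>x. deriv f (exp (Complex x \<Psi>)))" "continuous_on UNIV (\<lambda>x. f (exp (Complex x \<Psi>)))"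
    by (auto intro: continuous_on_compose2[OF _ cont_ray])
  then show "continuous_on UNIV log_deriv"
    unfolding ld[abs_def] using cont_ray f_nz[OF ray] by (intro continuous_intros) auto
  have der: "((\<lambda>z. L z - poly \<omega> z) has_field_derivative deriv f z / f z) (at z)" if z: "z \<in> sector \<Psi> \<epsilon>" for z
  proof -
    have dL: "(L has_field_derivative deriv L z) (at z)"
      using L(1) open_sector z by (rule holomorphic_derivI)
    have d1: "((\<lambda>z. exp (L z)) has_field_derivative exp (L z) * deriv L z) (at z)"
      by (rule derivative_eq_intros dL refl)+
    have df: "(f has_field_derivative deriv f z) (at z)"
      using f_holo by (intro holomorphic_derivI) auto
    have "((\<lambda>z. exp (poly \<omega> z) * f z) has_field_derivative
        exp (poly \<omega> z) * poly (pderiv \<omega>) z * f z + exp (poly \<omega> z) * deriv f z) (at z)"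
      by (rule derivative_eq_intros df poly_DERIV refl)+ simp
    then have "((\<lambda>z. exp (L z)) has_field_derivative
        exp (poly \<omega> z) * poly (pderiv \<omega>) z * f z + exp (poly \<omega> z) * deriv f z) (at z)"
      by (rule has_field_derivative_transform_within_open[OF _ open_sector z])
        (simp add: L(2) F f_def)
    then have "exp (L z) * deriv L z = exp (poly \<omega> z) * poly (pderiv \<omega>) z * f z + exp (poly \<omega> z) * deriv f z"
      using d1 DERIV_unique by blast
    moreover have "exp (L z) = exp (poly \<omega> z) * f z"
      using L(2)[OF z] F by (simp add: f_def)
    ultimately have "exp (poly \<omega> z) * (f z * deriv L z) = exp (poly \<omega> z) * (poly (pderiv \<omega>) z * f z + deriv f z)"
      by (simp add: algebra_simps)
    then have "f z * deriv L z = poly (pderiv \<omega>) z * f z + deriv f z"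
      by simp
    then have "deriv L z - poly (pderiv \<omega>) z = deriv f z / f z"
      using f_nz[OF z] by (simp add: field_simps)
    moreover have "((\<lambda>z. L z - poly \<omega> z) has_field_derivative deriv L z - poly (pderiv \<omega>) z) (at z)"
      by (intro DERIV_diff dL poly_DERIV)
    ultimately show ?thesis
      by simp
  qed
  have "((\<lambda>x. exp (Complex x \<Psi>)) has_vector_derivative exp (Complex x \<Psi>)) (at x)"
    unfolding Complex_eq by (auto intro!: has_vector_derivative_real_field derivative_eq_intros)
  from field_vector_diff_chain_at[OF this der[OF ray]]
  show "((\<lambda>x. L (exp (Complex x \<Psi>)) - poly \<omega> (exp (Complex x \<Psi>))) has_vector_derivative log_deriv x) (at x)"
    by (simp add: o_def ld)
qed


section \<open>Poles and value at zero of the zeta function\<close>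

theorem theorem3p3:
  fixes a :: "nat \<Rightarrow> complex" and \<alpha> \<Psi> \<epsilon> \<delta> :: real
    and F L :: "complex \<Rightarrow> complex"
    and d :: "nat \<Rightarrow> nat \<Rightarrow> complex" and m N M :: nat
  assumes "0 < cmod (a 0)" and "mono (\<lambda>n. cmod (a n))"
    and "filterlim (\<lambda>n. cmod (a n)) at_top sequentially"
    and "exponent_of_convergence a = ereal \<alpha>"
    and "\<epsilon> > 0" and "- pi \<le> \<Psi>" and "\<Psi> < pi"
    and "\<And>n. a n \<notin> sector \<Psi> \<epsilon>"
    and "minimal_characteristic_function a \<alpha> F"
    and "L holomorphic_on sector \<Psi> \<epsilon>"
    and "\<And>z. z \<in> sector \<Psi> \<epsilon> \<Longrightarrow> exp (L z) = F z"
    and "m \<ge> 1" and "N \<ge> 1" and "\<delta> > 0" and "real N / real m > \<alpha> - \<delta>"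
    and "(\<lambda>z. L z - (\<Sum>j=0..N. \<Sum>k=0..M. d j k *
                 branch_power (\<Psi> - \<epsilon>) (\<Psi> + \<epsilon>) z (of_real (\<alpha> - real j / real m)) *
                 branch_ln (\<Psi> - \<epsilon>) (\<Psi> + \<epsilon>) z ^ k))
         \<in> o[inf at_infinity (principal (sector \<Psi> \<epsilon>))](\<lambda>z.
                 branch_power (\<Psi> - \<epsilon>) (\<Psi> + \<epsilon>) z (of_real (\<alpha> - real N / real m - \<delta>)))"
  shows "(\<exists>Z. zeta_continuation a \<Psi> \<alpha> (\<alpha> - real N / real m - \<delta>) Z) \<and>
    (\<forall>Z. zeta_continuation a \<Psi> \<alpha> (\<alpha> - real N / real m - \<delta>) Z \<longrightarrow>
      (\<forall>j\<in>{0..N}. \<forall>kbar. {k \<in> {0..M}. d j k \<noteq> 0} \<noteq> {} \<and> kbar = Max {k \<in> {0..M}. d j k \<noteq> 0} \<longrightarrow>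
         (\<alpha> - real j / real m \<notin> \<int> \<longrightarrow>
            pole_of_order Z (of_real (\<alpha> - real j / real m)) (kbar + 1)) \<and>
         (\<alpha> - real j / real m \<in> \<int> - {0} \<longrightarrow>
            pole_of_order Z (of_real (\<alpha> - real j / real m)) kbar)) \<and>
      (M \<in> {0, 1} \<longrightarrow>
         Z analytic_on {0} \<and>
         ((\<forall>j\<in>{0..N}. \<alpha> - real j / real m \<noteq> 0) \<longrightarrow> Z 0 = 0) \<and>
         (\<forall>j'\<in>{0..N}. \<alpha> - real j' / real m = 0 \<longrightarrow> Z 0 = (if M = 0 then 0 else d j' 1))) \<and>
      (M \<ge> 2 \<longrightarrow>
         (\<forall>j'\<in>{0..N}. \<alpha> - real j' / real m = 0 \<and> d j' M \<noteq> 0 \<longrightarrow> pole_of_order Z 0 (M - 1))))"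
proof -
  note lim = assms(3)
  define \<sigma> where "\<sigma> = \<alpha> - real N / real m - \<delta>"
  define e where "e = (\<lambda>j::nat. \<alpha> - real j / real m)"
  have \<alpha>: "\<alpha> \<ge> 0"
    using exponent_of_convergence_nonneg[OF lim assms(4)] .
  have \<sigma>: "\<sigma> < 0"
    using assms(15) by (simp add: \<sigma>_def)
  have e_le: "e j \<le> \<alpha>" for j
    by (simp add: e_def)
  have e_gt: "\<sigma> < e j" if "j \<in> {0..N}" for j
  proof -
    have "real j / real m \<le> real N / real m"
      using that by (intro divide_right_mono) auto
    then show ?thesis
      using assms(14) by (simp add: \<sigma>_def e_def)
  qed
  have e_inj: "e j = e j' \<longleftrightarrow> j = j'" for j j'
    using assms(12) by (simp add: e_def)
  have a_nz: "a n \<noteq> 0" for n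
    using assms(1) monoD[OF assms(2), of 0 n] by auto
  have "\<exists>w. exp w = a n \<and> \<Psi> - 2 * pi + \<epsilon> \<le> Im w \<and> Im w \<le> \<Psi> - \<epsilon>" for n
    using log_outside_sector[OF assms(5) a_nz assms(8)] by blast
  then obtain b where b: "\<And>n. exp (b n) = a n" "\<And>n. \<Psi> - 2 * pi + \<epsilon> \<le> Im (b n)" "\<And>n. Im (b n) \<le> \<Psi> - \<epsilon>"
    by metis
  have \<epsilon>: "0 < \<epsilon>" "\<epsilon> \<le> pi"
    using assms(5) b(2,3)[of 0] by auto
  have ln_a: "ln (cmod (a n)) = Re (b n)" for n
    unfolding b(1)[symmetric] by simp
  interpret log_zeros b \<alpha> \<Psi> \<epsilon>
  proof
    show "summable (\<lambda>n. exp (- \<tau> * Re (b n)))" if "\<tau> > \<alpha>" for \<tau>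
      using exponent_of_convergence_summable[OF lim assms(4) that] by (simp add: ln_a)
  qed (use \<alpha> assms(5) b in auto)
  have power_a: "branch_power (\<Psi> - 2 * pi) \<Psi> (a n) (- s) = exp (- s * b n)" for n s
    unfolding b(1)[symmetric] using b(2,3)[of n] \<epsilon> by (intro branch_power_exp) auto
  obtain \<omega> where \<omega>: "degree \<omega> \<le> genus" "\<And>z. F z = exp (poly \<omega> z) * canonical_product a \<alpha> z"
    using assms(9) by (auto simp: minimal_characteristic_function_def)
  (* Left summands index the expansion of L, right summands the monomials of \<omega>. The factors
     exp (\<beta> * \<i> * \<Psi>) in the coefficients come from z^\<beta> = exp (\<beta> * x) * exp (\<beta> * \<i> * \<Psi>). *)
  define I where "I = ({0..N} \<times> {0..M}) <+> {0..genus}"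
  define c where "c = (\<lambda>i. case i of Inl (j, k) \<Rightarrow> d j k * exp (of_real (e j) * (\<i> * \<Psi>))
    | Inr l \<Rightarrow> - (coeff \<omega> l * exp (of_nat l * (\<i> * \<Psi>))))"
  define k where "k = (\<lambda>i::(nat \<times> nat) + nat. case i of Inl (j, k) \<Rightarrow> k | Inr l \<Rightarrow> 0)"
  define \<beta> where "\<beta> = (\<lambda>i::(nat \<times> nat) + nat. case i of Inl (j, k) \<Rightarrow> complex_of_real (e j) | Inr l \<Rightarrow> of_nat l)"
  define lam where "lam = (\<lambda>x. L (exp (Complex x \<Psi>)) - poly \<omega> (exp (Complex x \<Psi>)))"
  define main where "main = (\<lambda>x. \<Sum>i\<in>I. c i * ((of_real x + \<i> * \<Psi>) ^ k i * exp (\<beta> i * of_real x)))"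
  define R where "R = (\<lambda>x. lam x - main x)"
  note der = log_characteristic_function_derivative[OF b(1)[symmetric] lim \<omega>(2) assms(10,11), folded lam_def]
  have R_cont: "continuous_on UNIV R"
  proof -
    have "continuous_on UNIV lam"
      unfolding continuous_on_eq_continuous_within by (metis der(1) has_vector_derivative_continuous)
    then show ?thesis
      unfolding R_def main_def by (intro continuous_intros)
  qed
  have R_eq: "R x = L (exp (Complex x \<Psi>)) - (\<Sum>j=0..N. \<Sum>k=0..M. d j k *
       branch_power (\<Psi> - \<epsilon>) (\<Psi> + \<epsilon>) (exp (Complex x \<Psi>)) (of_real (e j)) *
       branch_ln (\<Psi> - \<epsilon>) (\<Psi> + \<epsilon>) (exp (Complex x \<Psi>)) ^ k)" for x
  proof -
    have w: "Complex x \<Psi> = of_real x + \<i> * \<Psi>"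
      by (simp add: Complex_eq)
    have ln_z: "branch_ln (\<Psi> - \<epsilon>) (\<Psi> + \<epsilon>) (exp (Complex x \<Psi>)) = of_real x + \<i> * \<Psi>"
      using \<epsilon> by (simp add: branch_ln_exp w[symmetric])
    have power_z: "branch_power (\<Psi> - \<epsilon>) (\<Psi> + \<epsilon>) (exp (Complex x \<Psi>)) \<gamma> = exp (\<gamma> * of_real x) * exp (\<gamma> * (\<i> * \<Psi>))" for \<gamma>
      unfolding branch_power_def ln_z by (simp add: exp_add distrib_left)
    have poly: "poly \<omega> (exp (Complex x \<Psi>)) = (\<Sum>l=0..genus. coeff \<omega> l * exp (of_nat l * Complex x \<Psi>))"
      unfolding poly_altdef exp_of_nat_mult
      using \<omega>(1) by (intro sum.mono_neutral_left) (auto simp: coeff_eq_0)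
    have "main x = (\<Sum>(j, k)\<in>{0..N} \<times> {0..M}. d j k * exp (of_real (e j) * (\<i> * \<Psi>)) *
          ((of_real x + \<i> * \<Psi>) ^ k * exp (of_real (e j) * of_real x))) +
        (\<Sum>l=0..genus. - (coeff \<omega> l * exp (of_nat l * (\<i> * \<Psi>))) * exp (of_nat l * of_real x))"
      unfolding main_def I_def by (subst sum.Plus) (auto simp: c_def k_def \<beta>_def intro!: sum.cong)
    also have "(\<Sum>l=0..genus. - (coeff \<omega> l * exp (of_nat l * (\<i> * \<Psi>))) * exp (of_nat l * of_real x)) =
        - poly \<omega> (exp (Complex x \<Psi>))"
      unfolding poly by (simp add: w sum_negf distrib_left exp_add mult_ac)
    also have "(\<Sum>(j, k)\<in>{0..N} \<times> {0..M}. d j k * exp (of_real (e j) * (\<i> * \<Psi>)) *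
          ((of_real x + \<i> * \<Psi>) ^ k * exp (of_real (e j) * of_real x))) =
        (\<Sum>j=0..N. \<Sum>k=0..M. d j k *
           branch_power (\<Psi> - \<epsilon>) (\<Psi> + \<epsilon>) (exp (Complex x \<Psi>)) (of_real (e j)) *
           branch_ln (\<Psi> - \<epsilon>) (\<Psi> + \<epsilon>) (exp (Complex x \<Psi>)) ^ k)"
      unfolding ln_z power_z by (subst sum.cartesian_product[symmetric]) (simp add: mult_ac)
    finally show ?thesis
      by (simp add: R_def lam_def)
  qed
  obtain C where C: "\<And>x. x \<ge> 0 \<Longrightarrow> norm (R x) \<le> C * exp (\<sigma> * x)"
  proof -
    have "eventually (\<lambda>x. norm (R x) \<le> exp (\<sigma> * x)) at_top"
      using smallo_on_ray[OF assms(16)[folded \<sigma>_def] \<epsilon>] by (simp add: R_eq e_def)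
    then have "eventually (\<lambda>x. norm (exp (- \<sigma> * x) *\<^sub>R R x) \<le> 1) at_top"
    proof eventually_elim
      case (elim x)
      have "exp (- \<sigma> * x) * norm (R x) \<le> exp (- \<sigma> * x) * exp (\<sigma> * x)"
        using elim by (intro mult_left_mono) auto
      then show ?case
        by (simp add: exp_add[symmetric])
    qed
    then obtain C where "C > 0" and C: "\<And>x. x \<ge> 0 \<Longrightarrow> norm (exp (- \<sigma> * x) *\<^sub>R R x) \<le> C"
      by (rule bounded_on_half_line[rotated])
        (auto intro!: continuous_intros continuous_on_subset[OF R_cont])
    show thesis
    proof (rule that)
      fix x :: real assume "x \<ge> 0"
      from C[OF this] have "exp (- \<sigma> * x) * norm (R x) * exp (\<sigma> * x) \<le> C * exp (\<sigma> * x)"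
        by (intro mult_right_mono) auto
      then show "norm (R x) \<le> C * exp (\<sigma> * x)"
        by (simp add: exp_minus field_simps)
    qed
  qed
  interpret E: log_zeros_expansion b \<alpha> \<Psi> \<epsilon> lam R I c k \<beta> \<sigma> C
  proof
    show "finite I"
      by (simp add: I_def)
    show "Re (\<beta> i) \<le> \<alpha>" if "i \<in> I" for i
      using that e_le genus(1) by (auto simp: I_def \<beta>_def)
    show "lam x = (\<Sum>i\<in>I. c i * ((of_real x + \<i> * \<Psi>) ^ k i * exp (\<beta> i * of_real x))) + R x" for x
      by (simp add: R_def main_def)
    show "continuous_on {0..} R"
      using R_cont by (rule continuous_on_subset) simp
  qed (use der C \<sigma> \<alpha> in auto)
  have continuation_iff: "zeta_continuation a \<Psi> \<alpha> \<sigma> Z \<longleftrightarrow>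
      Z nicely_meromorphic_on {s. Re s > \<sigma>} \<and> (\<forall>s. Re s > \<alpha> \<longrightarrow> Z s = zeta s)" for Z
    unfolding zeta_continuation_def power_a using zeta_sums sums_unique2 by metis
  (* Distinct j have distinct exponents, and the monomials of \<omega> have integer exponents and no
     logarithm, so at most one term of the expansion can match unless K = 0 at an integer. *)
  have coeff_sum: "(\<Sum>i | i \<in> I \<and> \<beta> i = of_real (e j) \<and> k i = K. c i) = d j K * exp (of_real (e j) * (\<i> * \<Psi>))"
    if "j \<in> {0..N}" "K \<le> M" "K > 0 \<or> e j \<notin> \<int>" for j K
  proof -
    have "of_nat l \<noteq> complex_of_real (e j)" if "e j \<notin> \<int>" for l
      using that by (metis Ints_of_nat of_real_eq_iff of_real_of_nat_eq)
    then have "i \<in> I \<and> \<beta> i = of_real (e j) \<and> k i = K \<longleftrightarrow> i = Inl (j, K)" for i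
      using that by (cases i) (auto simp: I_def \<beta>_def k_def e_inj)
    then have "{i. i \<in> I \<and> \<beta> i = of_real (e j) \<and> k i = K} = {Inl (j, K)}"
      by blast
    then show ?thesis
      by (simp add: c_def)
  qed
  have exponent_le: "k i \<le> K"
    if "i \<in> I" "\<beta> i = of_real (e j)" "c i \<noteq> 0" "\<And>k. k \<le> M \<Longrightarrow> d j k \<noteq> 0 \<Longrightarrow> k \<le> K" for i j K
    using that by (auto simp: I_def \<beta>_def k_def c_def e_inj split: sum.splits)
  have claim: "(\<forall>j\<in>{0..N}. \<forall>kbar. {k \<in> {0..M}. d j k \<noteq> 0} \<noteq> {} \<and> kbar = Max {k \<in> {0..M}. d j k \<noteq> 0} \<longrightarrow>
         (e j \<notin> \<int> \<longrightarrow> pole_of_order Z (of_real (e j)) (kbar + 1)) \<and>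
         (e j \<in> \<int> - {0} \<longrightarrow> pole_of_order Z (of_real (e j)) kbar)) \<and>
      (M \<in> {0, 1} \<longrightarrow>
         Z analytic_on {0} \<and>
         ((\<forall>j\<in>{0..N}. e j \<noteq> 0) \<longrightarrow> Z 0 = 0) \<and>
         (\<forall>j'\<in>{0..N}. e j' = 0 \<longrightarrow> Z 0 = (if M = 0 then 0 else d j' 1))) \<and>
      (M \<ge> 2 \<longrightarrow>
         (\<forall>j'\<in>{0..N}. e j' = 0 \<and> d j' M \<noteq> 0 \<longrightarrow> pole_of_order Z 0 (M - 1)))"
    if "zeta_continuation a \<Psi> \<alpha> \<sigma> Z" for Z
  proof (intro conjI ballI allI impI)
    have Z: "Z nicely_meromorphic_on {s. Re s > \<sigma>}" "\<And>s. Re s > \<alpha> \<Longrightarrow> Z s = zeta s"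
      using that by (auto simp: continuation_iff)
    {
      fix j K assume j: "j \<in> {0..N}" and K: "{k \<in> {0..M}. d j k \<noteq> 0} \<noteq> {} \<and> K = Max {k \<in> {0..M}. d j k \<noteq> 0}"
      have K': "K \<le> M" "d j K \<noteq> 0"
        using K Max_in[of "{k \<in> {0..M}. d j k \<noteq> 0}"] by auto
      have K_max: "k \<le> K" if "k \<le> M" "d j k \<noteq> 0" for k
        using K that by auto
      show "pole_of_order Z (of_real (e j)) (K + 1)" if nonint: "e j \<notin> \<int>"
      proof -
        have "pole_of_order Z (of_real (e j)) (Suc K)"
        proof (rule E.nonint_pole[OF Z nonint e_gt[OF j] e_le])
          show "k i \<le> K" if "i \<in> I" "\<beta> i = of_real (e j)" "c i \<noteq> 0" for i
            using exponent_le[OF that K_max] by simp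
          show "(\<Sum>i | i \<in> I \<and> \<beta> i = of_real (e j) \<and> k i = K. c i) \<noteq> 0"
            using coeff_sum[OF j K'(1)] nonint K' by simp
        qed
        then show ?thesis
          by simp
      qed
      assume "e j \<in> \<int> - {0}"
      then obtain n :: int where n: "e j = of_int n" "n \<noteq> 0"
        by (auto elim!: Ints_cases)
      have "pole_of_order Z (of_int n) K"
      proof (rule E.int_pole[OF Z n(2)])
        show "\<sigma> < of_int n" "of_int n \<le> \<alpha>"
          using e_gt[OF j] e_le[of j] n by auto
        show "k i \<le> K" if "i \<in> I" "\<beta> i = of_int n" "c i \<noteq> 0" for i
        proof -
          have "\<beta> i = of_real (e j)"
            using that(2) n by simp
          from exponent_le[OF that(1) this that(3) K_max] show ?thesis
            by simp
        qed
        show "(\<Sum>i | i \<in> I \<and> \<beta> i = of_int n \<and> k i = K. c i) \<noteq> 0" if "K > 0"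
          using coeff_sum[OF j K'(1)] that K' n by simp
      qed
      then show "pole_of_order Z (of_real (e j)) K"
        by (simp add: n)
    }
    {
      assume M: "M \<in> {0, 1}"
      have "k i \<le> 1" if "i \<in> I" for i
        using that M by (auto simp: I_def k_def)
      note zero = E.zero_regular[OF Z \<sigma> this]
      show "Z analytic_on {0}"
        by (rule zero(1))
      have Z0: "Z 0 = (\<Sum>i | i \<in> I \<and> \<beta> i = 0 \<and> k i = 1. c i)"
        by (rule zero(2))
      show "Z 0 = 0" if "\<forall>j\<in>{0..N}. e j \<noteq> 0"
      proof -
        have "{i. i \<in> I \<and> \<beta> i = 0 \<and> k i = 1} = {}"
          using that by (auto simp: I_def \<beta>_def k_def)
        then show ?thesis
          by (simp only: Z0 sum.empty)
      qed
      show "Z 0 = (if M = 0 then 0 else d j 1)" if j: "j \<in> {0..N}" "e j = 0" for j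
      proof (cases "M = 0")
        case True
        then have "{i. i \<in> I \<and> \<beta> i = 0 \<and> k i = 1} = {}"
          by (auto simp: I_def k_def)
        then have "Z 0 = 0"
          by (simp only: Z0 sum.empty)
        with True show ?thesis
          by simp
      next
        case False
        then show ?thesis
          using coeff_sum[OF j(1), of 1] j(2) M Z0 by simp
      qed
    }
    fix j assume M: "M \<ge> 2" and j: "j \<in> {0..N}" "e j = 0 \<and> d j M \<noteq> 0"
    have "k i \<le> M" if "i \<in> I" for i
      using that by (auto simp: I_def k_def)
    then show "pole_of_order Z 0 (M - 1)"
      using E.zero_pole[OF Z \<sigma> M] coeff_sum[OF j(1), of M] j M by simp
  qed
  have "\<exists>Z. zeta_continuation a \<Psi> \<alpha> \<sigma> Z"
    unfolding continuation_iff using E.continuation_exists by blast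
  with claim show ?thesis
    unfolding \<sigma>_def e_def by blast
qed

end
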